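(* Let $\mathbb{F}$ be a field. Let $X$ be a simplicial complex and let $\Gamma$ be a finite collection of subcomplexes of $X$ such that $\bigcup\Gamma=X$. Let $k$ and $\ell$ be two integers such that $-1\le k\le \ell<|\Gamma|$. Suppose that the following two conditions are satisfied: (1) $\widetilde{H}_{k-|\sigma|}\big(\bigcap\sigma,\mathbb{F}\big)=0$ for every simplex $\sigma\in N(\Gamma)$ of dimension at most $k$; (2) $\widetilde{H}_{|\sigma|-2}\big(\bigcup\sigma,\mathbb{F}\big)=0$ for every simplex $\sigma\in N(\Gamma)$ of dimension at least $k+1$ and at most $\ell$. Then $\dim\widetilde{H}_{\ell}(N(\Gamma),\mathbb{F})\le\dim\widetilde{H}_{\ell}(X,\mathbb{F})$.
   Context: Simplicial complexes are abstract and the empty set is not a simplex, so the minimal dimension of a simplex is $0$ (a complex may be empty). $\widetilde{H}$ denotes reduced simplicial homology; $\widetilde{H}_{-1}(Y,\mathbb{F})=0$ if and only if $Y$ is nonempty. A collection allows repetitions, and cardinalities are counted with repetitions. For a finite collection $\Gamma$ of subcomplexes of a simplicial complex, the nerve $N(\Gamma)$ is the simplicial complex whose vertices are the subcomplexes in $\Gamma$ and whose simplices are the (nonempty) subcollections of $\Gamma$ with nonempty intersection. For $\sigma\in N(\Gamma)$, $|\sigma|$ is the number of members of $\sigma$ (so $\dim\sigma=|\sigma|-1$), and $\bigcap\sigma$, $\bigcup\sigma$ are the intersection and the union of the subcomplexes in $\sigma$. *)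

theory Defs
  imports Complex_Main "HOL-Library.Poly_Mapping" "HOL-Library.Extended_Nat"
begin

section \<open>Simplicial complexes\<close>

definition simplicial_complex :: "'v set set \<Rightarrow> bool" where
  "simplicial_complex K \<longleftrightarrow>
     (\<forall>\<sigma>\<in>K. finite \<sigma> \<and> \<sigma> \<noteq> {} \<and> (\<forall>\<tau>. \<tau> \<subseteq> \<sigma> \<and> \<tau> \<noteq> {} \<longrightarrow> \<tau> \<in> K))"

definition subcomplex :: "'v set set \<Rightarrow> 'v set set \<Rightarrow> bool" where
  "subcomplex L K \<longleftrightarrow> simplicial_complex L \<and> L \<subseteq> K"

definition simplex_dim :: "'v set \<Rightarrow> int" where
  "simplex_dim \<sigma> = int (card \<sigma>) - 1"

text \<open>A collection with repetitions is a family \<open>\<Gamma>\<close> of complexes indexed by \<open>I\<close>; a subcollection is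
  a subset of \<open>I\<close>, so equal members with different indices are different vertices of the nerve.
  Complexes do not contain the empty simplex, so an intersection of complexes is the empty
  complex iff it is the empty set of simplices.\<close>

definition nerve :: "'i set \<Rightarrow> ('i \<Rightarrow> 'v set set) \<Rightarrow> 'i set set" where
  "nerve I \<Gamma> = {\<sigma>. \<sigma> \<subseteq> I \<and> finite \<sigma> \<and> \<sigma> \<noteq> {} \<and> (\<Inter>i\<in>\<sigma>. \<Gamma> i) \<noteq> {}}"

section \<open>Reduced simplicial homology over a field\<close>

text \<open>The simplices are oriented by a total order of the vertex type, chosen once and for all.
  As usual, homology does not depend on the choice up to isomorphism.\<close>

definition vertex_order :: "('v \<times> 'v) set" where
  "vertex_order = (SOME r. well_order_on UNIV r)"

definition vertex_less :: "'v \<Rightarrow> 'v \<Rightarrow> bool" where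
  "vertex_less u v \<longleftrightarrow> (u, v) \<in> vertex_order \<and> u \<noteq> v"

text \<open>A chain is a finitely supported function from simplices to scalars. The empty set is the
  basis element of the augmentation term, which lives in degree \<open>-1\<close> for every complex, the empty
  one included.\<close>

type_synonym ('v, 'f) chain = "'v set \<Rightarrow>\<^sub>0 'f"

definition scale_chain :: "'f \<Rightarrow> ('v, 'f::field) chain \<Rightarrow> ('v, 'f) chain" where
  "scale_chain a c = Poly_Mapping.map ((*) a) c"

definition chain_space :: "'v set set \<Rightarrow> int \<Rightarrow> ('v, 'f::field) chain set" where
  "chain_space K n = {c. Poly_Mapping.keys c \<subseteq> {\<sigma> \<in> insert {} K. simplex_dim \<sigma> = n}}"

text \<open>The linear extension of
  \<open>\<partial>[v\<^sub>0, \<dots>, v\<^sub>n] = \<Sum>i\<le>n. (-1)^i [v\<^sub>0, \<dots>, v\<^sub>i\<^sub>-\<^sub>1, v\<^sub>i\<^sub>+\<^sub>1, \<dots>, v\<^sub>n]\<close> for \<open>v\<^sub>0 < \<dots> < v\<^sub>n\<close>; here \<open>i\<close> is the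
  number of vertices below \<open>v\<^sub>i\<close>. In degree \<open>0\<close> this is the augmentation, since \<open>\<partial>[v] = {}\<close>.\<close>

definition vertex_sign :: "'v set \<Rightarrow> 'v \<Rightarrow> 'f::field" where
  "vertex_sign \<sigma> v = (-1) ^ card {u \<in> \<sigma>. vertex_less u v}"

definition boundary :: "('v, 'f::field) chain \<Rightarrow> ('v, 'f) chain" where
  "boundary c = (\<Sum>\<sigma>\<in>Poly_Mapping.keys c. \<Sum>v\<in>\<sigma>.
     Poly_Mapping.single (\<sigma> - {v}) (vertex_sign \<sigma> v * Poly_Mapping.lookup c \<sigma>))"

definition cycles :: "'v set set \<Rightarrow> int \<Rightarrow> ('v, 'f::field) chain set" where
  "cycles K n = {c \<in> chain_space K n. boundary c = 0}"

definition boundaries :: "'v set set \<Rightarrow> int \<Rightarrow> ('v, 'f::field) chain set" where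
  "boundaries K n = boundary ` chain_space K (n + 1)"

text \<open>The dimension of a quotient space \<open>Z / B\<close> as the supremum of the sizes of its finite linearly
  independent sets (\<open>\<infinity>\<close> if the dimension is infinite). A linear combination of classes vanishes in
  \<open>Z / B\<close> iff the same combination of representatives lies in \<open>B\<close>.\<close>

definition independent_modulo :: "('v, 'f::field) chain set \<Rightarrow> ('v, 'f) chain set \<Rightarrow> bool" where
  "independent_modulo B S \<longleftrightarrow>
     (\<forall>a. (\<Sum>z\<in>S. scale_chain (a z) z) \<in> B \<longrightarrow> (\<forall>z\<in>S. a z = 0))"

definition quotient_dim :: "('v, 'f::field) chain set \<Rightarrow> ('v, 'f) chain set \<Rightarrow> enat" where
  "quotient_dim Z B = (SUP S \<in> {S. finite S \<and> S \<subseteq> Z \<and> independent_modulo B S}. enat (card S))"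

definition reduced_homology_dim :: "'f::field itself \<Rightarrow> 'v set set \<Rightarrow> int \<Rightarrow> enat" where
  "reduced_homology_dim _ K n =
     quotient_dim (cycles K n :: ('v, 'f) chain set) (boundaries K n)"

definition reduced_homology_vanishes :: "'f::field itself \<Rightarrow> 'v set set \<Rightarrow> int \<Rightarrow> bool" where
  "reduced_homology_vanishes _ K n \<longleftrightarrow> (cycles K n :: ('v, 'f) chain set) = boundaries K n"

section \<open>Consistency of the definitions\<close>

lemma well_order_vertex_order: "well_order_on UNIV (vertex_order :: ('v \<times> 'v) set)"
  unfolding vertex_order_def by (rule someI_ex) (rule well_order_on)

lemma vertex_less_irrefl: "\<not> vertex_less v v"
  by (simp add: vertex_less_def)

lemma linear_order_vertex_order: "linear_order_on UNIV (vertex_order :: ('v \<times> 'v) set)"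
  using well_order_vertex_order unfolding well_order_on_def by (elim conjE)

lemma vertex_less_total:
  assumes "u \<noteq> v"
  shows "vertex_less u v \<or> vertex_less v u"
proof -
  have "total_on UNIV (vertex_order :: ('a \<times> 'a) set)"
    using linear_order_vertex_order unfolding linear_order_on_def by (elim conjE)
  then have "(u, v) \<in> vertex_order \<or> (v, u) \<in> vertex_order"
    using assms by (simp add: total_on_def)
  then show ?thesis
    using assms by (simp add: vertex_less_def)
qed

lemma vertex_less_asym:
  assumes "vertex_less u v"
  shows "\<not> vertex_less v u"
proof
  assume "vertex_less v u"
  moreover have "antisym (vertex_order :: ('a \<times> 'a) set)"
    using linear_order_vertex_order unfolding linear_order_on_def partial_order_on_def by (elim conjE)
  ultimately show False
    using assms by (auto simp: vertex_less_def dest: antisymD)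
qed

lemma boundary_superset:
  assumes "finite S" "Poly_Mapping.keys c \<subseteq> S"
  shows "boundary c = (\<Sum>\<sigma>\<in>S. \<Sum>v\<in>\<sigma>.
     Poly_Mapping.single (\<sigma> - {v}) (vertex_sign \<sigma> v * Poly_Mapping.lookup c \<sigma>))"
  unfolding boundary_def
  by (rule sum.mono_neutral_left) (use assms in \<open>auto simp: in_keys_iff\<close>)

lemma boundary_zero [simp]: "boundary 0 = 0"
  by (simp add: boundary_def)

lemma boundary_single:
  "boundary (Poly_Mapping.single \<sigma> a) =
     (\<Sum>v\<in>\<sigma>. Poly_Mapping.single (\<sigma> - {v}) (vertex_sign \<sigma> v * a))"
  by (subst boundary_superset[where S = "{\<sigma>}"]) auto

lemma boundary_add: "boundary (c + d) = boundary c + boundary d"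
proof -
  let ?S = "Poly_Mapping.keys c \<union> Poly_Mapping.keys d"
  have "Poly_Mapping.keys (c + d) \<subseteq> ?S"
    by (rule keys_add)
  then show ?thesis
    by (simp add: boundary_superset[where S = ?S] lookup_add distrib_left single_add sum.distrib)
qed

lemma boundary_sum: "boundary (\<Sum>x\<in>A. f x) = (\<Sum>x\<in>A. boundary (f x))"
  by (induction A rule: infinite_finite_induct) (auto simp: boundary_add)

lemma vertex_sign_remove:
  assumes "finite \<sigma>" "u \<in> \<sigma>"
  shows "vertex_sign (\<sigma> - {u}) v = (if vertex_less u v then - vertex_sign \<sigma> v else vertex_sign \<sigma> v)"
proof (cases "vertex_less u v")
  case True
  then have "{w \<in> \<sigma>. vertex_less w v} = insert u {w \<in> \<sigma> - {u}. vertex_less w v}"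
    using assms by auto
  then have "card {w \<in> \<sigma>. vertex_less w v} = Suc (card {w \<in> \<sigma> - {u}. vertex_less w v})"
    using assms by simp
  then show ?thesis
    using True by (simp add: vertex_sign_def)
next
  case False
  then have "{w \<in> \<sigma>. vertex_less w v} = {w \<in> \<sigma> - {u}. vertex_less w v}"
    by auto
  then show ?thesis
    using False by (simp add: vertex_sign_def)
qed

lemma boundary_boundary_single: "boundary (boundary (Poly_Mapping.single \<sigma> a)) = 0"
proof (cases "finite \<sigma>")
  case False
  then show ?thesis by (simp add: boundary_single)
next
  case fin: True
  define f where "f = (\<lambda>(u, v). Poly_Mapping.single (\<sigma> - {u} - {v})
     (vertex_sign (\<sigma> - {u}) v * (vertex_sign \<sigma> u * a)))"
  let ?P = "{(u, v). u \<in> \<sigma> \<and> v \<in> \<sigma> \<and> vertex_less u v}"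
  let ?Q = "{(u, v). u \<in> \<sigma> \<and> v \<in> \<sigma> \<and> vertex_less v u}"
  have "boundary (boundary (Poly_Mapping.single \<sigma> a)) = (\<Sum>u\<in>\<sigma>. \<Sum>v\<in>\<sigma> - {u}. f (u, v))"
    by (simp add: boundary_single boundary_sum f_def)
  also have "\<dots> = sum f (SIGMA u:\<sigma>. \<sigma> - {u})"
    using fin by (subst sum.Sigma) auto
  also have "(SIGMA u:\<sigma>. \<sigma> - {u}) = ?P \<union> ?Q"
    by (auto simp: vertex_less_irrefl dest: vertex_less_total)
  also have "sum f (?P \<union> ?Q) = sum f ?P + sum f ?Q"
  proof (rule sum.union_disjoint)
    show "finite ?P" "finite ?Q"
      by (rule finite_subset[of _ "\<sigma> \<times> \<sigma>"]; use fin in auto)+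
    show "?P \<inter> ?Q = {}"
      by (auto dest: vertex_less_asym)
  qed
  also have "sum f ?Q = (\<Sum>p\<in>?P. f (prod.swap p))"
    by (rule sum.reindex_bij_witness[of _ prod.swap prod.swap]) auto
  also have "\<dots> = (\<Sum>p\<in>?P. - f p)"
  proof (rule sum.cong)
    fix p assume "p \<in> ?P"
    then obtain u v where p: "p = (u, v)" "u \<in> \<sigma>" "v \<in> \<sigma>" "vertex_less u v"
      by auto
    then have "\<not> vertex_less v u"
      by (simp add: vertex_less_asym)
    moreover have "\<sigma> - {v} - {u} = \<sigma> - {u} - {v}"
      by auto
    ultimately show "f (prod.swap p) = - f p"
      using p fin by (simp add: f_def vertex_sign_remove single_uminus[symmetric] mult_ac)
  qed simp
  finally show ?thesis
    by (simp add: sum_negf)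
qed

lemma boundary_boundary: "boundary (boundary c) = 0"
proof -
  have "c = (\<Sum>\<sigma>\<in>Poly_Mapping.keys c. Poly_Mapping.single \<sigma> (Poly_Mapping.lookup c \<sigma>))"
    by (rule poly_mapping_eqI) (simp add: lookup_sum lookup_single when_def in_keys_iff)
  then have "boundary (boundary c) =
      (\<Sum>\<sigma>\<in>Poly_Mapping.keys c. boundary (boundary (Poly_Mapping.single \<sigma> (Poly_Mapping.lookup c \<sigma>))))"
    by (metis boundary_sum)
  then show ?thesis
    by (simp add: boundary_boundary_single)
qed

lemma boundary_in_chain_space:
  assumes "simplicial_complex K" "c \<in> chain_space K (n + 1)"
  shows "boundary c \<in> chain_space K n"
proof -
  have "\<sigma> - {v} \<in> insert {} K \<and> simplex_dim (\<sigma> - {v}) = n"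
    if "\<sigma> \<in> Poly_Mapping.keys c" "v \<in> \<sigma>" for \<sigma> v
  proof -
    have "\<sigma> \<in> insert {} K" "simplex_dim \<sigma> = n + 1"
      using that(1) assms(2) unfolding chain_space_def by blast+
    moreover have "\<sigma> \<noteq> {}"
      using that(2) by blast
    ultimately have "\<sigma> \<in> K" by simp
    then have "finite \<sigma>" and faces: "\<And>\<tau>. \<tau> \<subseteq> \<sigma> \<Longrightarrow> \<tau> \<noteq> {} \<Longrightarrow> \<tau> \<in> K"
      using assms(1) unfolding simplicial_complex_def by blast+
    have "\<sigma> - {v} \<in> insert {} K"
      using faces[of "\<sigma> - {v}"] by blast
    moreover have "card \<sigma> = Suc (card (\<sigma> - {v}))"
      using \<open>finite \<sigma>\<close> that(2) by (rule card.remove)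
    ultimately show ?thesis
      using \<open>simplex_dim \<sigma> = n + 1\<close> by (simp add: simplex_dim_def)
  qed
  then have "\<sigma> - {v} \<noteq> \<tau>"
    if "\<tau> \<notin> {\<sigma> \<in> insert {} K. simplex_dim \<sigma> = n}" "\<sigma> \<in> Poly_Mapping.keys c" "v \<in> \<sigma>" for \<sigma> \<tau> v
    using that by blast
  then have "Poly_Mapping.lookup (boundary c) \<tau> = 0"
    if "\<tau> \<notin> {\<sigma> \<in> insert {} K. simplex_dim \<sigma> = n}" for \<tau>
    using that unfolding boundary_def lookup_sum
    by (intro sum.neutral ballI) (simp only: lookup_single_not_eq not_False_eq_True)
  then show ?thesis
    by (auto simp: chain_space_def in_keys_iff)
qed

lemma boundaries_subset_cycles:
  "simplicial_complex K \<Longrightarrow> boundaries K n \<subseteq> cycles K n"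
  unfolding boundaries_def cycles_def using boundary_boundary boundary_in_chain_space by blast

lemma scale_chain_lookup: "Poly_Mapping.lookup (scale_chain a c) \<sigma> = a * Poly_Mapping.lookup c \<sigma>"
  by (simp add: scale_chain_def map.rep_eq when_def)

lemma boundary_scale: "boundary (scale_chain a c) = scale_chain a (boundary c)"
proof -
  have "Poly_Mapping.keys (scale_chain a c) \<subseteq> Poly_Mapping.keys c"
    by (auto simp: in_keys_iff scale_chain_lookup)
  then have "boundary (scale_chain a c) = (\<Sum>\<sigma>\<in>Poly_Mapping.keys c. \<Sum>v\<in>\<sigma>.
     Poly_Mapping.single (\<sigma> - {v}) (vertex_sign \<sigma> v * (a * Poly_Mapping.lookup c \<sigma>)))"
    by (simp add: boundary_superset[where S = "Poly_Mapping.keys c"] scale_chain_lookup)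
  then show ?thesis
    by (intro poly_mapping_eqI)
       (auto simp: scale_chain_lookup boundary_def lookup_sum lookup_single sum_distrib_left when_def
         intro!: sum.cong)
qed

lemma reduced_homology_vanishes_iff_dim:
  fixes K :: "'v set set"
  assumes "simplicial_complex K"
  shows "reduced_homology_vanishes TYPE('f::field) K n \<longleftrightarrow> reduced_homology_dim TYPE('f) K n = 0"
proof -
  let ?Z = "cycles K n :: ('v, 'f) chain set" and ?B = "boundaries K n :: ('v, 'f) chain set"
  have scale_B: "scale_chain a b \<in> ?B" if b: "b \<in> ?B" for a b
  proof -
    obtain c where "c \<in> chain_space K (n + 1)" "b = boundary c"
      using b by (auto simp: boundaries_def)
    moreover from this have "scale_chain a c \<in> chain_space K (n + 1)"
      by (auto simp: chain_space_def in_keys_iff scale_chain_lookup)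
    ultimately show ?thesis
      by (auto simp: boundaries_def boundary_scale[symmetric])
  qed
  have "?Z = ?B \<longleftrightarrow> ?Z \<subseteq> ?B"
    using boundaries_subset_cycles[OF assms] by blast
  also have "\<dots> \<longleftrightarrow> (\<forall>S. finite S \<and> S \<subseteq> ?Z \<and> independent_modulo ?B S \<longrightarrow> S = {})"
  proof (intro iffI allI impI subsetI)
    fix S
    assume ZB: "?Z \<subseteq> ?B" and S: "finite S \<and> S \<subseteq> ?Z \<and> independent_modulo ?B S"
    show "S = {}"
    proof (rule ccontr)
      assume "S \<noteq> {}"
      then obtain z where z: "z \<in> S" by blast
      have "(\<Sum>y\<in>S. scale_chain (if y = z then 1 else 0) y) = z"
        using S z by (intro poly_mapping_eqI) (simp add: lookup_sum scale_chain_lookup if_distrib if_distribR cong: if_cong)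
      moreover have "z \<in> ?B"
        using S ZB z by blast
      moreover have "(\<Sum>y\<in>S. scale_chain (a y) y) \<in> ?B \<Longrightarrow> a z = 0" for a
        using S z unfolding independent_modulo_def by blast
      from this[of "\<lambda>y. if y = z then 1 else 0"]
      have "(\<Sum>y\<in>S. scale_chain (if y = z then 1 else 0) y) \<notin> ?B"
        by auto
      ultimately show False
        by simp
    qed
  next
    fix z
    assume *: "\<forall>S. finite S \<and> S \<subseteq> ?Z \<and> independent_modulo ?B S \<longrightarrow> S = {}" and z: "z \<in> ?Z"
    show "z \<in> ?B"
    proof (rule ccontr)
      assume nB: "z \<notin> ?B"
      have "independent_modulo ?B {z}"
        unfolding independent_modulo_def
      proof (intro allI impI ballI)
        fix a y
        assume "(\<Sum>z\<in>{z}. scale_chain (a z) z) \<in> ?B" and "y \<in> {z}"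
        then have B: "scale_chain (a z) z \<in> ?B" and y: "y = z" by auto
        show "a y = 0"
        proof (rule ccontr)
          assume "a y \<noteq> 0"
          then have "scale_chain (inverse (a z)) (scale_chain (a z) z) = z"
            using y by (intro poly_mapping_eqI) (simp add: scale_chain_lookup)
          then show False
            using scale_B[OF B] nB by metis
        qed
      qed
      then have "{z} = {}"
        using * z by blast
      then show False by simp
    qed
  qed
  also have "\<dots> \<longleftrightarrow> quotient_dim ?Z ?B = 0"
    unfolding quotient_dim_def bot_enat_def[symmetric] SUP_bot_conv
    by (auto simp: bot_enat_def zero_enat_def)
  finally show ?thesis
    by (simp add: reduced_homology_vanishes_def reduced_homology_dim_def)
qed

lemma reduced_homology_vanishes_minus_one:
  assumes "simplicial_complex K"
  shows "reduced_homology_vanishes TYPE('f::field) K (-1) \<longleftrightarrow> K \<noteq> {}"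
proof
  assume van: "reduced_homology_vanishes TYPE('f) K (-1)"
  show "K \<noteq> {}"
  proof
    assume "K = {}"
    have "Poly_Mapping.single {} (1 :: 'f) \<in> cycles K (-1)"
      by (simp add: cycles_def chain_space_def simplex_dim_def boundary_single)
    moreover have "boundaries K (-1) \<subseteq> {0 :: ('a, 'f) chain}"
    proof -
      have "{\<sigma> \<in> insert {} K. simplex_dim \<sigma> = -1 + 1} = {}"
        using \<open>K = {}\<close> by (auto simp: simplex_dim_def)
      then have "c = 0" if "c \<in> chain_space K (-1 + 1)" for c :: "('a, 'f) chain"
        using that unfolding chain_space_def by (intro poly_mapping_eqI) (simp add: not_in_keys_iff_lookup_eq_zero[symmetric], blast)
      then show ?thesis
        unfolding boundaries_def by (metis boundary_zero image_subsetI singletonI)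
    qed
    ultimately have "Poly_Mapping.single {} 1 \<in> {0 :: ('a, 'f) chain}"
      using van unfolding reduced_homology_vanishes_def by blast
    then show False
      by (auto dest!: arg_cong[where f = "\<lambda>c. Poly_Mapping.lookup c {}"])
  qed
next
  assume "K \<noteq> {}"
  then obtain v where v: "{v} \<in> K"
    using assms unfolding simplicial_complex_def by (metis empty_subsetI ex_in_conv insert_not_empty insert_subset)
  have "z \<in> boundaries K (-1)" if "z \<in> cycles K (-1)" for z :: "('a, 'f) chain"
  proof -
    define a where "a = Poly_Mapping.lookup z {}"
    have "card \<sigma> > 0" if "\<sigma> \<in> K" for \<sigma>
      using assms that unfolding simplicial_complex_def card_gt_0_iff by blast
    then have "Poly_Mapping.keys z \<subseteq> {{}}"
      using that unfolding cycles_def chain_space_def simplex_dim_def by fastforce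
    then have "z = Poly_Mapping.single {} a"
      by (intro poly_mapping_eqI) (auto simp: a_def lookup_single when_def in_keys_iff)
    moreover have "{u \<in> {v}. vertex_less u v} = {}"
      by (auto simp: vertex_less_irrefl)
    then have "vertex_sign {v} v = (1 :: 'f)"
      by (simp only: vertex_sign_def card.empty power_0)
    then have "Poly_Mapping.single {} a = boundary (Poly_Mapping.single {v} a)"
      by (simp add: boundary_single)
    moreover have "boundary (Poly_Mapping.single {v} a) \<in> boundaries K (-1)"
      using v by (auto simp: boundaries_def chain_space_def simplex_dim_def)
    ultimately show ?thesis by simp
  qed
  then show "reduced_homology_vanishes TYPE('f) K (-1)"
    using boundaries_subset_cycles[OF assms] unfolding reduced_homology_vanishes_def by blast
qed

end

theory Submission
  imports Defs
begin

text \<open>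
  For a nonempty simplex \<open>s\<close> of \<open>X\<close> all members of the cover containing \<open>s\<close> span a full simplex, so the
  complex of pairs \<open>(t, s)\<close> with \<open>t \<subseteq> I\<close> and \<open>s \<in> \<Inter>\<^sub>i\<^sub>\<in>\<^sub>t \<Gamma>\<^sub>i\<close>, which contains both \<open>N(\<Gamma>)\<close> (\<open>s = {}\<close>) and
  \<open>X\<close> (\<open>t = {}\<close>), has the homology of \<open>N(\<Gamma>)\<close>. It therefore suffices to show that every \<open>l\<close>-cycle \<open>z\<close>
  of the nerve is homologous in it to a cycle of \<open>X\<close>. In degree \<open>k\<close> the bounding chain is built by the usual
  zig-zag, filling cycles in the intersections by condition (1). The passage from degree \<open>m\<close> to
  \<open>m + 1\<close> is done on basis elements: if \<open>\<sigma>\<close> has \<open>m + 2\<close> members, the cycle of \<open>\<Union>\<sigma>\<close> associated with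
  \<open>\<partial>\<sigma>\<close> is \<open>\<partial>y\<close> for some \<open>y\<close> by condition (2). The cycle formed by \<open>\<sigma>\<close>, \<open>y\<close> and the chain joining
  their boundaries then bounds, because the complex of the subcover \<open>\<sigma>\<close> has the homology of a simplex.
  When the basis elements are summed to a cycle, the joining chains cancel by linearity.
\<close>

section \<open>Linear algebra of chains\<close>

abbreviation coeff :: "('v, 'f::field) chain \<Rightarrow> 'v set \<Rightarrow> 'f" where
  "coeff \<equiv> Poly_Mapping.lookup"

abbreviation chain_linear :: "(('v, 'f::field) chain \<Rightarrow> ('w, 'f) chain) \<Rightarrow> bool" where
  "chain_linear \<equiv> Vector_Spaces.linear scale_chain scale_chain"

interpretation chain: vector_space "scale_chain :: 'f::field \<Rightarrow> ('v, 'f) chain \<Rightarrow> ('v, 'f) chain"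
  by unfold_locales
    (auto intro!: poly_mapping_eqI simp: scale_chain_lookup lookup_add algebra_simps)

interpretation chain_pair: vector_space_pair
  "scale_chain :: 'f::field \<Rightarrow> ('v, 'f) chain \<Rightarrow> ('v, 'f) chain"
  "scale_chain :: 'f::field \<Rightarrow> ('w, 'f) chain \<Rightarrow> ('w, 'f) chain"
  by unfold_locales

lemma chain_linearI:
  assumes "\<And>x y. f (x + y) = f x + f y" "\<And>a x. f (scale_chain a x) = scale_chain a (f x)"
  shows "chain_linear f"
  by (simp add: Vector_Spaces.linear_iff assms chain.vector_space_axioms)

lemma chain_linearD:
  assumes "chain_linear f"
  shows "f (x + y) = f x + f y" "f (scale_chain a x) = scale_chain a (f x)" "f 0 = 0"
    "f (x - y) = f x - f y" "f (- x) = - f x" "f (sum g A) = (\<Sum>x\<in>A. f (g x))"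
proof -
  interpret Vector_Spaces.linear scale_chain scale_chain f by (rule assms)
  show "f (x + y) = f x + f y" "f (scale_chain a x) = scale_chain a (f x)" "f 0 = 0"
    "f (x - y) = f x - f y" "f (- x) = - f x" "f (sum g A) = (\<Sum>x\<in>A. f (g x))"
    by (rule add scale zero diff neg sum)+
qed

lemma chain_linear_boundary: "chain_linear boundary"
  by (simp add: chain_linearI boundary_add boundary_scale)

lemmas boundary_linear = chain_linearD[OF chain_linear_boundary]

lemma chain_space_iff:
  "c \<in> chain_space K n \<longleftrightarrow>
     (\<forall>s. coeff c s \<noteq> 0 \<longrightarrow> s \<in> insert {} K \<and> int (card s) = n + 1)"
  by (auto simp: chain_space_def in_keys_iff simplex_dim_def subset_iff)

lemma boundary_coeff:
  assumes "coeff (boundary c) t \<noteq> 0"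
  obtains s v where "coeff c s \<noteq> 0" "finite s" "v \<in> s" "t = s - {v}"
proof -
  from assms obtain s where s: "s \<in> Poly_Mapping.keys c"
    "(\<Sum>v\<in>s. coeff (Poly_Mapping.single (s - {v}) (vertex_sign s v * coeff c s)) t) \<noteq> 0"
    unfolding boundary_def lookup_sum by (meson sum.not_neutral_contains_not_neutral)
  then obtain v where v: "v \<in> s"
    "coeff (Poly_Mapping.single (s - {v}) (vertex_sign s v * coeff c s)) t \<noteq> 0"
    by (meson sum.not_neutral_contains_not_neutral)
  have "finite s"
    using s(2) by (metis sum.infinite)
  moreover have "t = s - {v}"
    using v(2) by (metis lookup_single_not_eq)
  ultimately show thesis
    using that s v by (auto simp: in_keys_iff)
qed

lemma chain_expand:
  assumes "finite S" "Poly_Mapping.keys c \<subseteq> S"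
  shows "c = (\<Sum>s\<in>S. scale_chain (coeff c s) (Poly_Mapping.single s 1))"
proof (rule poly_mapping_eqI)
  fix t
  have "coeff (\<Sum>s\<in>S. scale_chain (coeff c s) (Poly_Mapping.single s 1)) t =
      (\<Sum>s\<in>S. if s = t then coeff c s else 0)"
    by (simp add: lookup_sum scale_chain_lookup lookup_single when_def if_distrib cong: if_cong)
  then show "coeff c t = coeff (\<Sum>s\<in>S. scale_chain (coeff c s) (Poly_Mapping.single s 1)) t"
    using assms by (auto simp: in_keys_iff)
qed

text \<open>A linear map has a linear right inverse on the image of a subspace, so fillings can be
  chosen linearly in the boundary. This keeps the zig-zag linear in the cycle being lifted.\<close>

lemma boundary_section:
  obtains g :: "('v, 'f::field) chain \<Rightarrow> ('v, 'f) chain"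
  where "chain_linear g"
    "\<And>b. b \<in> boundaries K n \<Longrightarrow> g b \<in> chain_space K (n + 1) \<and> boundary (g b) = b"
proof -
  have "chain.subspace (chain_space K (n + 1) :: ('v, 'f) chain set)"
    by (rule chain.subspaceI; simp add: chain_space_iff lookup_add scale_chain_lookup)
      (metis add.right_neutral)
  from chain_pair.linear_exists_right_inverse_on[OF chain_linear_boundary this]
  obtain g :: "('v, 'f) chain \<Rightarrow> ('v, 'f) chain" where
    "g ` UNIV \<subseteq> chain_space K (n + 1)" "chain_linear g"
    "\<forall>b\<in>boundary ` chain_space K (n + 1). boundary (g b) = b"
    by blast
  then show thesis
    by (intro that[of g]) (auto simp: boundaries_def)
qed

text \<open>A relation modulo \<open>B'\<close> among images pulls back through \<open>inj\<close>
  to a relation modulo \<open>B\<close>, so independent sets go to independent sets of the same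
  size.\<close>

lemma quotient_dim_mono:
  fixes f :: "('v, 'f::field) chain \<Rightarrow> ('w, 'f) chain"
  assumes lin: "chain_linear f" and Z: "chain.subspace Z"
    and maps: "f ` Z \<subseteq> Z'" and inj: "\<And>z. z \<in> Z \<Longrightarrow> f z \<in> B' \<Longrightarrow> z \<in> B"
    and B': "0 \<in> B'"
  shows "quotient_dim Z B \<le> quotient_dim Z' B'"
proof -
  note f = chain_linearD[OF lin]
  have "\<exists>T. finite T \<and> T \<subseteq> Z' \<and> independent_modulo B' T \<and> card T = card S"
    if S: "finite S" "S \<subseteq> Z" "independent_modulo B S" for S
  proof (intro exI conjI)
    show "finite (f ` S)" "f ` S \<subseteq> Z'"
      using S maps by auto
    have key: "\<forall>z\<in>S. a z = 0" if "(\<Sum>z\<in>S. scale_chain (a z) (f z)) \<in> B'" for a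
    proof -
      have "(\<Sum>z\<in>S. scale_chain (a z) z) \<in> Z"
        using S Z by (intro chain.subspace_sum chain.subspace_scale) auto
      moreover have "f (\<Sum>z\<in>S. scale_chain (a z) z) \<in> B'"
        using that by (simp add: f)
      ultimately have "(\<Sum>z\<in>S. scale_chain (a z) z) \<in> B"
        using inj by blast
      then show ?thesis
        using S(3) unfolding independent_modulo_def by blast
    qed
    have inj_S: "inj_on f S"
    proof (rule inj_onI, rule ccontr)
      fix x y assume xy: "x \<in> S" "y \<in> S" "f x = f y" "x \<noteq> y"
      \<comment> \<open>A collision would give the relation \<open>f x - f y = 0\<close>, whose
        coefficient 1 at \<open>x\<close> is nonzero in every characteristic.\<close>
      let ?a = "\<lambda>z. if z = x then 1 else if z = y then - 1 else (0::'f)"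
      have "(\<Sum>z\<in>S. scale_chain (?a z) (f z)) = (\<Sum>z\<in>{x, y}. scale_chain (?a z) (f z))"
        using S xy by (intro sum.mono_neutral_right) auto
      also have "\<dots> = 0"
        using xy by simp
      finally have "\<forall>z\<in>S. ?a z = 0"
        using B' by (intro key) simp
      then show False
        using xy by auto
    qed
    then show "card (f ` S) = card S"
      by (rule card_image)
    show "independent_modulo B' (f ` S)"
      unfolding independent_modulo_def
      using key[of "\<lambda>z. a (f z)" for a] by (auto simp: sum.reindex[OF inj_S])
  qed
  then show ?thesis
    unfolding quotient_dim_def
    by (intro SUP_mono) (metis (mono_tags, lifting) mem_Collect_eq order_refl)
qed

lemma subspace_cycles: "chain.subspace (cycles K n)"
  by (rule chain.subspaceI; simp add: cycles_def boundary_linear chain_space_iff lookup_add scale_chain_lookup)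
    (metis add.right_neutral)

section \<open>Signs\<close>

lemma vertex_sign_square [simp]: "vertex_sign s v * vertex_sign s v = (1 :: 'f::field)"
  by (simp add: vertex_sign_def flip: power_add mult_2)

text \<open>Exactly one of \<open>u\<close> and \<open>v\<close> precedes the other, so exactly one
  of the two signs flips when the other vertex is removed. The first identity serves the square of
  \<open>nerve_bd\<close>, the second the contracting homotopy.\<close>

lemma vertex_sign_swap:
  assumes "finite s" "u \<in> s" "v \<in> s" "u \<noteq> v"
  shows "vertex_sign (s - {v}) u * vertex_sign s v = - (vertex_sign (s - {u}) v * vertex_sign s u :: 'f::field)"
    and "vertex_sign (s - {v}) u * vertex_sign (s - {u}) v = - (vertex_sign s v * vertex_sign s u :: 'f::field)"
  using vertex_less_total[OF assms(4)] vertex_less_asym[of u v] vertex_less_asym[of v u] assms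
  by (auto simp: vertex_sign_remove mult_ac)

text \<open>The sum is split along a linear order because in characteristic 2 antisymmetry alone does
  not make the sum vanish.\<close>

lemma sum_antisym:
  fixes f :: "'i \<Rightarrow> 'i \<Rightarrow> 'a::ab_group_add"
  assumes "finite A" "\<And>i j. i \<in> A \<Longrightarrow> j \<in> A \<Longrightarrow> i \<noteq> j \<Longrightarrow> f j i = - f i j"
  shows "(\<Sum>i\<in>A. \<Sum>j\<in>A - {i}. f i j) = 0"
proof -
  let ?L = "\<lambda>i j. i \<noteq> j \<and> vertex_less i j" and ?G = "\<lambda>i j. i \<noteq> j \<and> vertex_less j i"
  have "(\<Sum>i\<in>A. \<Sum>j\<in>A - {i}. f i j) =
      (\<Sum>i\<in>A. \<Sum>j\<in>A. (if ?L i j then f i j else 0) + (if ?G i j then f i j else 0))"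
  proof (rule sum.cong[OF refl])
    fix i assume "i \<in> A"
    have "(\<Sum>j\<in>A - {i}. f i j) = (\<Sum>j\<in>A. if i = j then 0 else f i j)"
      using assms(1) by (intro sum.mono_neutral_cong_left) auto
    also have "\<dots> = (\<Sum>j\<in>A. (if ?L i j then f i j else 0) + (if ?G i j then f i j else 0))"
    proof (rule sum.cong[OF refl])
      fix j
      show "(if i = j then 0 else f i j) = (if ?L i j then f i j else 0) + (if ?G i j then f i j else 0)"
        using vertex_less_total[of i j] vertex_less_asym[of i j] by (cases "i = j") auto
    qed
    finally show "(\<Sum>j\<in>A - {i}. f i j) = \<dots>" .
  qed
  also have "\<dots> = (\<Sum>i\<in>A. \<Sum>j\<in>A. if ?L i j then f i j else 0) + (\<Sum>i\<in>A. \<Sum>j\<in>A. if ?G i j then f i j else 0)"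
    by (simp only: sum.distrib)
  also have "(\<Sum>i\<in>A. \<Sum>j\<in>A. if ?G i j then f i j else 0) = (\<Sum>i\<in>A. \<Sum>j\<in>A. if ?L i j then f j i else 0)"
    by (subst sum.swap) (auto intro!: sum.cong)
  also have "\<dots> = - (\<Sum>i\<in>A. \<Sum>j\<in>A. if ?L i j then f i j else 0)"
    by (auto simp: sum_negf[symmetric] assms(2) intro!: sum.cong)
  finally show ?thesis
    by simp
qed

text \<open>Gathers the cofaces of \<open>t\<close> instead of the faces of the simplices in
  \<open>c\<close>; \<open>nerve_bd\<close> has the same form.\<close>

lemma coeff_boundary:
  fixes c :: "('i, 'f::field) chain"
  assumes I: "finite I" and c: "\<And>s. coeff c s \<noteq> 0 \<Longrightarrow> s \<subseteq> I"
  shows "coeff (boundary c) t = (\<Sum>i\<in>I - t. vertex_sign (insert i t) i * coeff c (insert i t))"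
proof -
  let ?g = "\<lambda>(s, v). (vertex_sign s v * coeff c s when s - {v} = t)"
  have keys: "Poly_Mapping.keys c \<subseteq> Pow I"
    using c by (auto simp: in_keys_iff)
  have "coeff (boundary c) t = (\<Sum>s\<in>Pow I. \<Sum>v\<in>s. ?g (s, v))"
    using I by (simp add: boundary_superset[OF _ keys] lookup_sum lookup_single)
  also have "\<dots> = sum ?g (SIGMA s:Pow I. s)"
    using I by (subst sum.Sigma) (auto intro: finite_subset)
  also have "\<dots> = (\<Sum>(s, v)\<in>{(s, v). s \<subseteq> I \<and> v \<in> s \<and> s - {v} = t}. vertex_sign s v * coeff c s)"
  proof (rule sum.mono_neutral_cong_right)
    show "finite (SIGMA s:Pow I. s)"
      using I by (intro finite_SigmaI) (auto intro: finite_subset)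
  qed (auto simp: when_def split: if_splits)
  also have "\<dots> = (\<Sum>i\<in>{i\<in>I - t. t \<subseteq> I}. vertex_sign (insert i t) i * coeff c (insert i t))"
    by (rule sum.reindex_bij_witness[of _ "\<lambda>i. (insert i t, i)" snd]) (auto simp: insert_absorb)
  also have "\<dots> = (\<Sum>i\<in>I - t. vertex_sign (insert i t) i * coeff c (insert i t))"
    using I c by (intro sum.mono_neutral_left) auto
  finally show ?thesis .
qed

section \<open>The double complex of a cover\<close>

locale cover =
  fixes I :: "'i set" and \<Gamma> :: "'i \<Rightarrow> 'v set set"
  assumes finite_I: "finite I"
    and complexes: "\<And>i. i \<in> I \<Longrightarrow> simplicial_complex (\<Gamma> i)"
begin

text \<open>\<open>J\<close> stands for a subcover. The union over \<open>J\<close> is what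
  constrains \<open>s\<close> when \<open>t\<close> is empty. The empty \<open>s\<close>, which
  belongs to no complex, has its own case, so that its row is the augmented chain complex of the
  nerve of the subcover.\<close>

definition cell :: "'i set \<Rightarrow> 'i set \<Rightarrow> 'v set \<Rightarrow> bool" where
  "cell J t s \<longleftrightarrow> t \<subseteq> J \<and>
     (if s = {} then t = {} \<or> t \<in> nerve I \<Gamma> else s \<in> (\<Union>i\<in>J. \<Gamma> i) \<and> (\<forall>i\<in>t. s \<in> \<Gamma> i))"

text \<open>A chain of the double complex is a function \<open>w\<close>; its coefficient at the pair \<open>(t, s)\<close> is
  \<open>coeff (w t) s\<close>, and this pair has total degree \<open>|s| + |t| - 1\<close>, as the simplex \<open>s \<squnion> t\<close> of the join.\<close>

definition bichains :: "'i set \<Rightarrow> int \<Rightarrow> ('i set \<Rightarrow> ('v, 'f::field) chain) set" where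
  "bichains J n =
     {w. \<forall>t s. coeff (w t) s \<noteq> 0 \<longrightarrow> cell J t s \<and> int (card s) + int (card t) = n + 1}"

text \<open>The boundary in the nerve direction: the value at \<open>t\<close> collects what the
  cofaces \<open>insert i t\<close> send to their face \<open>t\<close>.\<close>

definition nerve_bd :: "('i set \<Rightarrow> ('v, 'f::field) chain) \<Rightarrow> 'i set \<Rightarrow> ('v, 'f) chain" where
  "nerve_bd w t = (\<Sum>i\<in>I - t. scale_chain (vertex_sign (insert i t) i) (w (insert i t)))"

text \<open>The sign \<open>(- 1) ^ card t\<close> makes the space and nerve directions
  anticommute.\<close>

definition total_bd :: "('i set \<Rightarrow> ('v, 'f::field) chain) \<Rightarrow> 'i set \<Rightarrow> ('v, 'f) chain" where
  "total_bd w t = scale_chain ((- 1) ^ card t) (boundary (w t)) + nerve_bd w t"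

definition from_nerve :: "('i, 'f::field) chain \<Rightarrow> 'i set \<Rightarrow> ('v, 'f) chain" where
  "from_nerve z t = Poly_Mapping.single {} (coeff z t)"

definition from_space :: "('v, 'f::field) chain \<Rightarrow> 'i set \<Rightarrow> ('v, 'f) chain" where
  "from_space y t = (if t = {} then y else 0)"

section \<open>Closure properties of cells and bichains\<close>

lemma bichainsI:
  assumes "\<And>t s. coeff (w t) s \<noteq> 0 \<Longrightarrow> cell J t s \<and> int (card s) + int (card t) = n + 1"
  shows "w \<in> bichains J n"
  using assms by (simp add: bichains_def)

lemma bichainsD:
  assumes "w \<in> bichains J n" "coeff (w t) s \<noteq> 0"
  shows "cell J t s" "int (card s) + int (card t) = n + 1"
  using assms by (auto simp: bichains_def)

lemma bichains_eq_0:
  assumes "w \<in> bichains J n" "\<not> t \<subseteq> J"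
  shows "w t = 0"
  using bichainsD(1)[OF assms(1), of t] assms(2) by (intro poly_mapping_eqI) (auto simp: cell_def)

lemma bichains_zero: "(\<lambda>_. 0) \<in> bichains J n"
  by (simp add: bichains_def)

lemma bichains_add:
  assumes "v \<in> bichains J n" "w \<in> bichains J n"
  shows "(\<lambda>t. v t + w t) \<in> bichains J n"
  using assms unfolding bichains_def mem_Collect_eq lookup_add by (metis add.right_neutral)

lemma bichains_scale:
  assumes "w \<in> bichains J n"
  shows "(\<lambda>t. scale_chain a (w t)) \<in> bichains J n"
  using assms by (auto simp: bichains_def scale_chain_lookup)

lemma bichains_diff:
  assumes "v \<in> bichains J n" "w \<in> bichains J n"
  shows "(\<lambda>t. v t - w t) \<in> bichains J n"
  using assms unfolding bichains_def mem_Collect_eq lookup_minus by (metis diff_0_right)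

lemma bichains_sum:
  assumes "\<And>x. x \<in> A \<Longrightarrow> w x \<in> bichains J n"
  shows "(\<lambda>t. \<Sum>x\<in>A. w x t) \<in> bichains J n"
  using assms by (induction A rule: infinite_finite_induct) (auto simp: bichains_zero bichains_add)

lemma cell_mono:
  assumes "cell J t s" "J \<subseteq> J'"
  shows "cell J' t s"
  using assms by (auto simp: cell_def split: if_splits)

lemma bichains_mono:
  assumes "w \<in> bichains J n" "J \<subseteq> J'"
  shows "w \<in> bichains J' n"
  using assms cell_mono unfolding bichains_def by blast

lemma cell_finite:
  assumes "cell J t s" "J \<subseteq> I"
  shows "finite t" "finite s"
proof -
  show "finite t"
    using assms finite_I by (meson cell_def finite_subset)
  show "finite s"
  proof (cases "s = {}")
    case False
    then obtain i where "i \<in> I" "s \<in> \<Gamma> i"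
      using assms by (auto simp: cell_def)
    then show ?thesis
      using complexes unfolding simplicial_complex_def by blast
  qed simp
qed

lemma nerveI:
  assumes "t \<subseteq> I" "t \<noteq> {}" "\<And>i. i \<in> t \<Longrightarrow> s \<in> \<Gamma> i"
  shows "t \<in> nerve I \<Gamma>"
proof -
  have "s \<in> (\<Inter>i\<in>t. \<Gamma> i)"
    using assms(3) by blast
  then show ?thesis
    using assms(1,2) finite_subset[OF assms(1) finite_I] unfolding nerve_def by blast
qed

lemma simplicial_complex_nerve: "simplicial_complex (nerve I \<Gamma>)"
proof -
  have "u \<in> nerve I \<Gamma>" if "t \<in> nerve I \<Gamma>" "u \<subseteq> t" "u \<noteq> {}" for t u
  proof -
    have "(\<Inter>i\<in>t. \<Gamma> i) \<noteq> {}" and "t \<subseteq> I"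
      using that(1) by (simp_all add: nerve_def)
    then obtain s where "s \<in> (\<Inter>i\<in>t. \<Gamma> i)"
      by (meson ex_in_conv)
    with \<open>t \<subseteq> I\<close> show ?thesis
      using that(2,3) by (intro nerveI[of u s]) blast+
  qed
  moreover have "finite t \<and> t \<noteq> {}" if "t \<in> nerve I \<Gamma>" for t
    using that unfolding nerve_def by blast
  ultimately show ?thesis
    unfolding simplicial_complex_def by blast
qed

text \<open>If \<open>s\<close> is a single vertex, its face is empty, and \<open>s\<close> itself
  witnesses that a nonempty \<open>t\<close> lies in the nerve.\<close>

lemma cell_remove_space:
  assumes "cell J t s" "J \<subseteq> I"
  shows "cell J t (s - {v})"
proof (cases "s = {}")
  case False
  then have s: "t \<subseteq> J" "s \<in> (\<Union>i\<in>J. \<Gamma> i)" "\<forall>i\<in>t. s \<in> \<Gamma> i"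
    using assms by (auto simp: cell_def)
  have "s - {v} \<in> \<Gamma> i" if "s \<in> \<Gamma> i" "i \<in> I" "s - {v} \<noteq> {}" for i
    using complexes[OF that(2)] that by (meson Diff_subset simplicial_complex_def)
  then have "s - {v} \<in> (\<Union>i\<in>J. \<Gamma> i) \<and> (\<forall>i\<in>t. s - {v} \<in> \<Gamma> i)" if "s - {v} \<noteq> {}"
    using s assms(2) that by blast
  moreover have "t = {} \<or> t \<in> nerve I \<Gamma>"
    using s assms(2) nerveI[of t s] by auto
  ultimately show ?thesis
    using s(1) by (simp add: cell_def)
qed (use assms in simp)

lemma cell_subset_nerve:
  assumes "cell J t s" "u \<subseteq> t"
  shows "cell J u s"
proof -
  have "u \<in> nerve I \<Gamma>" if "t \<in> nerve I \<Gamma>" "u \<noteq> {}"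
    using simplicial_complex_nerve that assms(2) unfolding simplicial_complex_def by blast
  then show ?thesis
    using assms by (auto simp: cell_def split: if_splits)
qed

lemma nerve_bd_coeff:
  "coeff (nerve_bd w t) s = (\<Sum>i\<in>I - t. vertex_sign (insert i t) i * coeff (w (insert i t)) s)"
  by (simp add: nerve_bd_def lookup_sum scale_chain_lookup)

lemma nerve_bd_bichains:
  assumes w: "w \<in> bichains J (n + 1)" and J: "J \<subseteq> I"
  shows "nerve_bd w \<in> bichains J n"
proof (rule bichainsI)
  fix t s
  assume "coeff (nerve_bd w t) s \<noteq> 0"
  then obtain i where "i \<in> I - t" "vertex_sign (insert i t) i * coeff (w (insert i t)) s \<noteq> 0"
    unfolding nerve_bd_coeff by (rule sum.not_neutral_contains_not_neutral)
  then have i: "i \<in> I - t" "coeff (w (insert i t)) s \<noteq> 0"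
    by simp_all
  note c = bichainsD[OF w i(2)]
  have "finite t"
    using cell_finite[OF c(1) J] by simp
  then show "cell J t s \<and> int (card s) + int (card t) = n + 1"
    using c i cell_subset_nerve[OF c(1), of t] by auto
qed

lemma total_bd_bichains:
  assumes w: "w \<in> bichains J (n + 1)" and J: "J \<subseteq> I"
  shows "total_bd w \<in> bichains J n"
proof -
  have "(\<lambda>t. boundary (w t)) \<in> bichains J n"
  proof (rule bichainsI)
    fix t s
    assume "coeff (boundary (w t)) s \<noteq> 0"
    then obtain r v where r: "coeff (w t) r \<noteq> 0" "finite r" "v \<in> r" "s = r - {v}"
      by (rule boundary_coeff)
    then have "card r = Suc (card s)"
      by (simp only: card_Suc_Diff1)
    then show "cell J t s \<and> int (card s) + int (card t) = n + 1"
      using bichainsD[OF w r(1)] cell_remove_space[OF bichainsD(1)[OF w r(1)] J, of v] r(4)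
      by simp
  qed
  then have "(\<lambda>t. scale_chain ((- 1) ^ card t) (boundary (w t))) \<in> bichains J n"
    by (auto simp: bichains_def scale_chain_lookup)
  then show ?thesis
    unfolding total_bd_def using nerve_bd_bichains[OF w J] by (rule bichains_add)
qed

section \<open>Linearity of the total boundary and vanishing of its square\<close>

lemma nerve_bd_linear:
  "nerve_bd (\<lambda>t. v t + w t) t = nerve_bd v t + nerve_bd w t"
  "nerve_bd (\<lambda>t. v t - w t) t = nerve_bd v t - nerve_bd w t"
  "nerve_bd (\<lambda>t. scale_chain a (w t)) t = scale_chain a (nerve_bd w t)"
  "nerve_bd (\<lambda>t. 0) t = 0"
  by (simp_all add: nerve_bd_def chain.scale_right_distrib chain.scale_right_diff_distrib
      sum.distrib sum_subtractf chain.scale_sum_right mult.commute)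

lemma total_bd_linear:
  "total_bd (\<lambda>t. v t + w t) t = total_bd v t + total_bd w t"
  "total_bd (\<lambda>t. v t - w t) t = total_bd v t - total_bd w t"
  "total_bd (\<lambda>t. scale_chain a (w t)) t = scale_chain a (total_bd w t)"
  "total_bd (\<lambda>t. 0) t = 0"
  by (simp_all add: total_bd_def nerve_bd_linear boundary_linear chain.scale_right_distrib
      chain.scale_right_diff_distrib mult.commute)

lemma total_bd_sum: "total_bd (\<lambda>t. \<Sum>x\<in>A. w x t) t = (\<Sum>x\<in>A. total_bd (w x) t)"
  by (induction A rule: infinite_finite_induct) (auto simp: total_bd_linear)

lemma boundary_nerve_bd: "boundary (nerve_bd w t) = nerve_bd (\<lambda>t. boundary (w t)) t"
  by (simp add: nerve_bd_def boundary_linear)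

text \<open>The two orders of inserting \<open>i\<close> and \<open>j\<close> contribute opposite
  terms.\<close>

lemma nerve_bd_nerve_bd:
  assumes "finite t"
  shows "nerve_bd (nerve_bd w) t = 0"
proof -
  have "nerve_bd (nerve_bd w) t =
      (\<Sum>i\<in>I - t. \<Sum>j\<in>I - t - {i}. scale_chain
        (vertex_sign (insert i t) i * vertex_sign (insert j (insert i t)) j) (w (insert j (insert i t))))"
    by (auto simp: nerve_bd_def chain.scale_sum_right intro!: sum.cong)
  also have "\<dots> = 0"
  proof (rule sum_antisym)
    fix i j
    assume ij: "i \<in> I - t" "j \<in> I - t" "i \<noteq> j"
    let ?s = "insert j (insert i t)"
    have "?s - {j} = insert i t" "?s - {i} = insert j t" "insert i (insert j t) = ?s"
      using ij by auto
    then show "scale_chain (vertex_sign (insert j t) j * vertex_sign (insert i (insert j t)) i)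
          (w (insert i (insert j t))) =
        - scale_chain (vertex_sign (insert i t) i * vertex_sign ?s j) (w ?s)"
      using vertex_sign_swap(1)[of ?s i j, where 'f = 'a] assms ij
      by (simp flip: chain.scale_minus_left)
  qed (use finite_I in simp)
  finally show ?thesis .
qed

text \<open>For finite \<open>t\<close> the sign \<open>(- 1) ^ card t\<close> changes on every
  coface, so the mixed terms cancel.\<close>

lemma total_bd_total_bd:
  assumes "finite t"
  shows "total_bd (total_bd w) t = 0"
proof -
  have "nerve_bd (\<lambda>t. scale_chain ((- 1) ^ card t) (boundary (w t))) t =
      - scale_chain ((- 1) ^ card t) (nerve_bd (\<lambda>t. boundary (w t)) t)"
    using assms by (simp add: nerve_bd_def chain.scale_sum_right mult.commute flip: sum_negf chain.scale_minus_left)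
  then show ?thesis
    using nerve_bd_nerve_bd[OF assms, of w]
    unfolding total_bd_def
    by (simp add: nerve_bd_linear boundary_linear boundary_boundary boundary_nerve_bd)
qed

section \<open>The nerve and the space inside the double complex\<close>

lemma nerve_bd_from_nerve:
  assumes "\<And>t. coeff z t \<noteq> 0 \<Longrightarrow> t \<subseteq> I"
  shows "nerve_bd (from_nerve z) t = from_nerve (boundary z) t"
proof (rule poly_mapping_eqI)
  fix s
  show "coeff (nerve_bd (from_nerve z) t) s = coeff (from_nerve (boundary z) t) s"
    by (cases "s = {}")
      (simp_all add: nerve_bd_coeff from_nerve_def lookup_single_not_eq coeff_boundary[OF finite_I assms])
qed

lemma boundary_from_nerve [simp]: "boundary (from_nerve z t) = 0"
  by (simp add: from_nerve_def boundary_single)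

lemma total_bd_from_nerve:
  assumes "\<And>t. coeff z t \<noteq> 0 \<Longrightarrow> t \<subseteq> I"
  shows "total_bd (from_nerve z) t = from_nerve (boundary z) t"
  using nerve_bd_from_nerve[OF assms] by (simp add: total_bd_def)

lemma from_nerve_linear:
  "from_nerve (x + y) t = from_nerve x t + from_nerve y t"
  "from_nerve (x - y) t = from_nerve x t - from_nerve y t"
  "from_nerve (scale_chain a x) t = scale_chain a (from_nerve x t)"
  "from_nerve 0 t = 0"
  by (auto intro!: poly_mapping_eqI
      simp: from_nerve_def lookup_add lookup_minus scale_chain_lookup lookup_single when_def)

lemma from_nerve_bichains:
  assumes "z \<in> chain_space (nerve I \<Gamma>) n" "\<And>t. coeff z t \<noteq> 0 \<Longrightarrow> t \<subseteq> J"
  shows "from_nerve z \<in> bichains J n"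
  using assms by (intro bichainsI) (auto simp: from_nerve_def lookup_single when_def cell_def chain_space_iff split: if_splits)

text \<open>No coface is empty, so a chain concentrated at \<open>t = {}\<close> has no boundary in
  the nerve direction.\<close>

lemma total_bd_from_space: "total_bd (from_space y) t = from_space (boundary y) t"
  by (simp add: total_bd_def from_space_def nerve_bd_def)

lemma from_space_bichains:
  assumes "y \<in> chain_space (\<Union>i\<in>J. \<Gamma> i) n"
  shows "from_space y \<in> bichains J n"
  using assms by (intro bichainsI) (auto simp: from_space_def cell_def chain_space_iff split: if_splits)

lemma bichains_component:
  assumes "w \<in> bichains J n"
  shows "w {} \<in> chain_space (\<Union>i\<in>J. \<Gamma> i) n"
  unfolding chain_space_iff
proof (intro allI impI)
  fix s
  assume s: "coeff (w {}) s \<noteq> 0"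
  show "s \<in> insert {} (\<Union>i\<in>J. \<Gamma> i) \<and> int (card s) = n + 1"
    using bichainsD[OF assms s] by (cases "s = {}") (auto simp: cell_def)
qed

section \<open>Reduction to the nerve\<close>

text \<open>The apex used to contract the full simplex of all indices in \<open>J\<close> whose
  member contains \<open>s\<close>.\<close>

definition member_of :: "'i set \<Rightarrow> 'v set \<Rightarrow> 'i" where
  "member_of J s = (SOME i. i \<in> J \<and> s \<in> \<Gamma> i)"

text \<open>The cone operator in the nerve direction. It is given coefficientwise because the apex
  depends on \<open>s\<close>. The empty \<open>s\<close> is left out, since its row is the chain
  complex of the nerve and need not be exact.\<close>

definition homotopy :: "'i set \<Rightarrow> ('i set \<Rightarrow> ('v, 'f::field) chain) \<Rightarrow> 'i set \<Rightarrow> ('v, 'f) chain" where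
  "homotopy J w t = Abs_poly_mapping (\<lambda>s. if finite t \<and> s \<noteq> {} \<and> member_of J s \<in> t
     then vertex_sign t (member_of J s) * coeff (w (t - {member_of J s})) s else 0)"

lemma member_of:
  assumes "s \<in> (\<Union>i\<in>J. \<Gamma> i)"
  shows "member_of J s \<in> J" "s \<in> \<Gamma> (member_of J s)"
proof -
  have "\<exists>i. i \<in> J \<and> s \<in> \<Gamma> i"
    using assms by blast
  from someI_ex[OF this] show "member_of J s \<in> J" "s \<in> \<Gamma> (member_of J s)"
    by (simp_all add: member_of_def)
qed

lemma coeff_homotopy:
  "coeff (homotopy J w t) s = (if finite t \<and> s \<noteq> {} \<and> member_of J s \<in> t
     then vertex_sign t (member_of J s) * coeff (w (t - {member_of J s})) s else 0)"
proof -
  let ?f = "\<lambda>s. if finite t \<and> s \<noteq> {} \<and> member_of J s \<in> t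
     then vertex_sign t (member_of J s) * coeff (w (t - {member_of J s})) s else 0"
  have "finite {s. ?f s \<noteq> 0}"
  proof (cases "finite t")
    case True
    have "{s. ?f s \<noteq> 0} \<subseteq> (\<Union>i\<in>t. Poly_Mapping.keys (w (t - {i})))"
      by (auto simp: in_keys_iff)
    then show ?thesis
      by (rule finite_subset) (use True in simp)
  qed simp
  then show ?thesis
    by (simp add: homotopy_def)
qed

lemma homotopy_bichains:
  assumes w: "w \<in> bichains J n" and J: "J \<subseteq> I"
  shows "homotopy J w \<in> bichains J (n + 1)"
proof (rule bichainsI)
  fix t s
  assume "coeff (homotopy J w t) s \<noteq> 0"
  then have t: "finite t" and s: "s \<noteq> {}" and mem: "member_of J s \<in> t"
    and nz: "coeff (w (t - {member_of J s})) s \<noteq> 0"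
    by (auto simp: coeff_homotopy split: if_splits)
  note c = bichainsD[OF w nz]
  have "s \<in> (\<Union>i\<in>J. \<Gamma> i)"
    using c(1) s by (simp add: cell_def)
  note m = member_of[OF this]
  have "t \<subseteq> J" "\<forall>i\<in>t. s \<in> \<Gamma> i"
    using c(1) m s by (auto simp: cell_def)
  then have "cell J t s"
    using s \<open>s \<in> (\<Union>i\<in>J. \<Gamma> i)\<close> by (simp add: cell_def)
  moreover have "card t = Suc (card (t - {member_of J s}))"
    using t mem by (simp only: card_Suc_Diff1)
  ultimately show "cell J t s \<and> int (card s) + int (card t) = n + 1 + 1"
    using c(2) by simp
qed

text \<open>This is the cone identity \<open>d h + h d = id\<close> in the row of \<open>s\<close>,
  where \<open>d\<close> is \<open>nerve_bd\<close> and the term \<open>h d\<close> vanishes by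
  \<open>cycle\<close>.\<close>

lemma nerve_bd_homotopy:
  fixes w :: "'i set \<Rightarrow> ('v, 'f::field) chain"
  assumes J: "J \<subseteq> I" and t: "t \<subseteq> I" and s: "s \<noteq> {}" "s \<in> (\<Union>i\<in>J. \<Gamma> i)"
    and cycle: "\<And>u. coeff (nerve_bd w u) s = 0"
  shows "coeff (nerve_bd (homotopy J w) t) s = coeff (w t) s"
proof -
  define i where "i = member_of J s"
  have i: "i \<in> I"
    using member_of[OF s(2)] J by (auto simp: i_def)
  have fin: "finite t"
    using t finite_I by (rule finite_subset)
  have eq: "coeff (nerve_bd (homotopy J w) t) s = (\<Sum>j\<in>I - t. vertex_sign (insert j t) j *
      (if i \<in> insert j t then vertex_sign (insert j t) i * coeff (w (insert j t - {i})) s else 0))"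
    using s(1) fin by (simp add: nerve_bd_coeff coeff_homotopy flip: i_def cong: if_cong)
  show ?thesis
  proof (cases "i \<in> t")
    case False
    \<comment> \<open>The apex lies outside \<open>t\<close>, so among the cofaces only
      \<open>insert i t\<close> contains it.\<close>
    have "coeff (nerve_bd (homotopy J w) t) s = (\<Sum>j\<in>I - t. if j = i then coeff (w t) s else 0)"
      unfolding eq using False by (intro sum.cong) (auto simp flip: mult.assoc)
    then show ?thesis
      using False i finite_I by simp
  next
    case True
    \<comment> \<open>Now every coface of \<open>t\<close> contains the apex. The cycle condition at
      \<open>t - {i}\<close> expresses \<open>w t\<close> through these cofaces.\<close>
    let ?g = "\<lambda>j. vertex_sign (insert j t - {i}) j * coeff (w (insert j t - {i})) s"
    have "I - (t - {i}) = insert i (I - t)"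
      using i by blast
    then have "coeff (nerve_bd w (t - {i})) s =
        vertex_sign t i * coeff (w t) s + (\<Sum>j\<in>I - t. vertex_sign (insert j (t - {i})) j * coeff (w (insert j (t - {i}))) s)"
      using True finite_I by (simp add: nerve_bd_coeff insert_absorb)
    also have "(\<Sum>j\<in>I - t. vertex_sign (insert j (t - {i})) j * coeff (w (insert j (t - {i}))) s) = sum ?g (I - t)"
    proof (rule sum.cong[OF refl])
      fix j assume "j \<in> I - t"
      then have "insert j (t - {i}) = insert j t - {i}"
        using True by auto
      then show "vertex_sign (insert j (t - {i})) j * coeff (w (insert j (t - {i}))) s = ?g j"
        by simp
    qed
    finally have "vertex_sign t i * coeff (w t) s = - sum ?g (I - t)"
      using cycle[of "t - {i}"] by (simp add: eq_neg_iff_add_eq_0)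
    then have "vertex_sign t i * (vertex_sign t i * coeff (w t) s) = - (\<Sum>j\<in>I - t. vertex_sign t i * ?g j)"
      by (simp add: sum_distrib_left)
    then have "coeff (w t) s = - (\<Sum>j\<in>I - t. vertex_sign t i * ?g j)"
      by (simp flip: mult.assoc)
    also have "\<dots> = (\<Sum>j\<in>I - t. vertex_sign (insert j t) j * (vertex_sign (insert j t) i * coeff (w (insert j t - {i})) s))"
      unfolding sum_negf[symmetric]
    proof (rule sum.cong[OF refl])
      fix j assume j: "j \<in> I - t"
      then have "insert j t - {j} = t"
        by auto
      moreover have "i \<noteq> j"
        using j True by blast
      ultimately show "- (vertex_sign t i * ?g j) =
          vertex_sign (insert j t) j * (vertex_sign (insert j t) i * coeff (w (insert j t - {i})) s)"
        using vertex_sign_swap(2)[of "insert j t" i j, where 'f = 'f] fin True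
        by (simp flip: mult.assoc)
    qed
    finally show ?thesis
      unfolding eq using True by simp
  qed
qed

text \<open>Away from the nerve the rows of the double complex are augmented chain complexes of full
  simplices, hence exact; this lets one strip off the cells \<open>(t, s)\<close> with \<open>s\<close> largest.\<close>

lemma reduce_to_nerve:
  fixes w :: "'i set \<Rightarrow> ('v, 'f::field) chain"
  assumes w: "w \<in> bichains J n" and J: "J \<subseteq> I"
    and bd: "\<And>t s. s \<noteq> {} \<Longrightarrow> coeff (total_bd w t) s = 0"
  obtains c u where "c \<in> chain_space (nerve I \<Gamma>) n" "\<And>t. coeff c t \<noteq> 0 \<Longrightarrow> t \<subseteq> J"
    "u \<in> bichains J (n + 1)" "\<And>t. w t = from_nerve c t + total_bd u t"
proof -
  \<comment> \<open>\<open>q\<close> bounds the size of \<open>s\<close>; each induction step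
    removes the cells with largest \<open>s\<close> by subtracting a total boundary.\<close>
  have "\<exists>c u. c \<in> chain_space (nerve I \<Gamma>) n \<and> (\<forall>t. coeff c t \<noteq> 0 \<longrightarrow> t \<subseteq> J) \<and>
      u \<in> bichains J (n + 1) \<and> (\<forall>t. w t = from_nerve c t + total_bd u t)"
    if "\<forall>t s. coeff (w t) s \<noteq> 0 \<longrightarrow> card s \<le> q" for q
    using that w bd
  proof (induction q arbitrary: w)
    case 0
    have s: "s = {}" if "coeff (w t) s \<noteq> 0" for t s
    proof -
      have "card s = 0"
        using 0(1) that by simp
      then show ?thesis
        using cell_finite(2)[OF bichainsD(1)[OF 0(2) that] J] by simp
    qed
    \<comment> \<open>Only cells with empty \<open>s\<close> are left, and their coefficients form a
      chain of the nerve.\<close>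
    define c where "c = Abs_poly_mapping (\<lambda>t. coeff (w t) {})"
    have "{t. coeff (w t) {} \<noteq> 0} \<subseteq> Pow J"
      using bichainsD(1)[OF 0(2)] by (auto simp: cell_def)
    then have "finite {t. coeff (w t) {} \<noteq> 0}"
      using J finite_I by (meson finite_Pow_iff finite_subset)
    then have c: "coeff c t = coeff (w t) {}" for t
      by (simp add: c_def)
    have "c \<in> chain_space (nerve I \<Gamma>) n" "\<forall>t. coeff c t \<noteq> 0 \<longrightarrow> t \<subseteq> J"
      using bichainsD[OF 0(2), of _ "{}"] by (auto simp: chain_space_iff c cell_def)
    moreover have "w t = from_nerve c t + total_bd (\<lambda>_. 0) t" for t
    proof (rule poly_mapping_eqI)
      fix r
      show "coeff (w t) r = coeff (from_nerve c t + total_bd (\<lambda>_. 0) t) r"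
        using s[of t r] by (auto simp: total_bd_linear from_nerve_def c lookup_single when_def)
    qed
    ultimately show ?case
      using bichains_zero by blast
  next
    case (Suc q)
    let ?h = "homotopy J w"
    \<comment> \<open>On cells with \<open>card s = Suc q\<close> the nerve part of
      \<open>total_bd ?h\<close> equals \<open>w\<close>, and its space part does not reach
      them.\<close>
    define w' where "w' = (\<lambda>t. w t - total_bd ?h t)"
    have h: "?h \<in> bichains J (n + 1)"
      using Suc.prems(2) J by (rule homotopy_bichains)
    have bdh: "total_bd ?h \<in> bichains J n"
      using h J by (rule total_bd_bichains)
    have w': "w' \<in> bichains J n"
      unfolding w'_def using Suc.prems(2) bdh by (rule bichains_diff)
    have "total_bd w' t = total_bd w t" for t
    \<comment> \<open>Subsets of \<open>I\<close> are finite, as \<open>total_bd_total_bd\<close>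
      demands; for other \<open>t\<close> both sides vanish.\<close>
    proof (cases "t \<subseteq> I")
      case True
      then show ?thesis
        using finite_I by (simp add: w'_def total_bd_linear total_bd_total_bd finite_subset)
    next
      case False
      then have "\<not> t \<subseteq> J"
        using J by blast
      moreover have "total_bd w' \<in> bichains J (n - 1)" "total_bd w \<in> bichains J (n - 1)"
        using w' Suc.prems(2) J by (simp_all add: total_bd_bichains)
      ultimately show ?thesis
        by (simp add: bichains_eq_0)
    qed
    then have bd': "coeff (total_bd w' t) s = 0" if "s \<noteq> {}" for t s
      using Suc.prems(3) that by simp
    have "card s \<le> q" if nz: "coeff (w' t) s \<noteq> 0" for t s
    proof (rule ccontr)
      assume large: "\<not> card s \<le> q"
      note c = bichainsD(1)[OF w' nz]
      have "s \<noteq> {}"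
        using large by auto
      then have s: "s \<noteq> {}" "s \<in> (\<Union>i\<in>J. \<Gamma> i)"
        using c by (simp_all add: cell_def)
      have t: "t \<subseteq> I"
        using c J by (auto simp: cell_def)
      \<comment> \<open>\<open>s\<close> has at least \<open>Suc q\<close> vertices, so only a
        simplex with more than \<open>Suc q\<close> vertices could have it as a facet.\<close>
      have no_bd: "coeff (boundary (v u)) s = 0"
        if v: "\<And>u r. coeff (v u) r \<noteq> 0 \<Longrightarrow> card r \<le> Suc q" for v :: "'i set \<Rightarrow> ('v, 'f) chain" and u
      proof (rule ccontr)
        assume "coeff (boundary (v u)) s \<noteq> 0"
        then obtain r x where r: "coeff (v u) r \<noteq> 0" "finite r" "x \<in> r" "s = r - {x}"
          by (rule boundary_coeff)
        then have "card r = Suc (card s)"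
          by (simp only: card_Suc_Diff1)
        then show False
          using v[OF r(1)] large by simp
      qed
      have "coeff (nerve_bd w u) s = 0" for u
        using Suc.prems(3)[OF s(1), of u] no_bd[of w u] Suc.prems(1)
        by (simp add: total_bd_def lookup_add scale_chain_lookup)
      then have "coeff (nerve_bd ?h t) s = coeff (w t) s"
        by (intro nerve_bd_homotopy J t s)
      moreover have "coeff (boundary (?h t)) s = 0"
        using Suc.prems(1) by (intro no_bd) (auto simp: coeff_homotopy split: if_splits)
      ultimately show False
        using nz by (simp add: w'_def total_bd_def lookup_add lookup_minus scale_chain_lookup)
    qed
    from Suc.IH[OF _ w' bd'] this obtain c u where cu: "c \<in> chain_space (nerve I \<Gamma>) n"
      "\<forall>t. coeff c t \<noteq> 0 \<longrightarrow> t \<subseteq> J" "u \<in> bichains J (n + 1)"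
      "\<forall>t. w' t = from_nerve c t + total_bd u t"
      by blast
    have "w t = from_nerve c t + total_bd (\<lambda>t. u t + ?h t) t" for t
    proof -
      have "w' t = from_nerve c t + total_bd u t"
        using cu(4) by blast
      then have "w t = from_nerve c t + total_bd u t + total_bd ?h t"
        by (simp add: w'_def diff_eq_eq)
      then show ?thesis
        by (simp add: total_bd_linear add.assoc)
    qed
    then show ?case
      using cu(1,2) bichains_add[OF cu(3) h] by blast
  qed
  \<comment> \<open>The total degree gives the initial bound on the size of
    \<open>s\<close>.\<close>
  moreover have "\<forall>t s. coeff (w t) s \<noteq> 0 \<longrightarrow> card s \<le> nat (n + 1)"
    using bichainsD(2)[OF w] by fastforce
  ultimately show thesis
    using that by blast
qed

section \<open>Lifting cycles of the nerve\<close>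

lemma chain_linear_from_nerve: "chain_linear (\<lambda>z. from_nerve z t)"
  by (simp add: chain_linearI from_nerve_linear)

lemma cycles_nerveD:
  assumes "z \<in> cycles (nerve I \<Gamma>) n"
  shows "z \<in> chain_space (nerve I \<Gamma>) n" "boundary z = 0" "coeff z t \<noteq> 0 \<Longrightarrow> t \<subseteq> I"
    "coeff z t \<noteq> 0 \<Longrightarrow> int (card t) = n + 1"
    "coeff z t \<noteq> 0 \<Longrightarrow> t = {} \<or> t \<in> nerve I \<Gamma>"
proof -
  show z: "z \<in> chain_space (nerve I \<Gamma>) n" and "boundary z = 0"
    using assms by (simp_all add: cycles_def)
  show "coeff z t \<noteq> 0 \<Longrightarrow> int (card t) = n + 1"
    and mem: "coeff z t \<noteq> 0 \<Longrightarrow> t = {} \<or> t \<in> nerve I \<Gamma>"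
    using z by (auto simp: chain_space_iff)
  show "coeff z t \<noteq> 0 \<Longrightarrow> t \<subseteq> I"
    using mem by (auto simp: nerve_def)
qed

text \<open>Since \<open>total_bd\<close> squares to zero, the claim reduces to
  \<open>nerve_bd (total_bd w) t = 0\<close>. This sees only cofaces of \<open>t\<close>, where
  \<open>total_bd w\<close> is the cycle \<open>z\<close>.\<close>

lemma boundary_total_bd_eq_0:
  assumes "finite t" and z: "z \<in> cycles (nerve I \<Gamma>) n"
    and eq: "\<And>i. i \<in> I - t \<Longrightarrow> total_bd w (insert i t) = from_nerve z (insert i t)"
  shows "boundary (total_bd w t) = 0"
proof -
  have "nerve_bd (total_bd w) t = nerve_bd (from_nerve z) t"
    using eq by (simp add: nerve_bd_def)
  also have "\<dots> = 0"
    using cycles_nerveD[OF z] by (simp add: nerve_bd_from_nerve from_nerve_linear)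
  finally have "scale_chain ((- 1) ^ card t) (boundary (total_bd w t)) = 0"
    using total_bd_total_bd[OF assms(1), of w] unfolding total_bd_def[of "total_bd w"] by simp
  then show ?thesis
    by simp
qed

text \<open>Applying \<open>total_bd\<close> to the decomposition of \<open>w\<close> kills the
  \<open>u\<close> term; comparing coefficients at the empty \<open>s\<close> gives the
  claim.\<close>

lemma boundary_of_reduction:
  assumes w: "\<And>t. w t = from_nerve c t + total_bd u t" and bd: "\<And>t. total_bd w t = from_nerve z t"
    and c: "\<And>t. coeff c t \<noteq> 0 \<Longrightarrow> t \<subseteq> I" and z: "\<And>t. coeff z t \<noteq> 0 \<Longrightarrow> t \<subseteq> I"
  shows "z = boundary c"
proof (rule poly_mapping_eqI)
  fix t
  show "coeff z t = coeff (boundary c) t"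
  proof (cases "t \<subseteq> I")
    case True
    have "w = (\<lambda>t. from_nerve c t + total_bd u t)"
      using w by blast
    then have "from_nerve z t = from_nerve (boundary c) t"
      using bd[of t] total_bd_total_bd[OF finite_subset[OF True finite_I], of u]
      by (simp add: total_bd_linear total_bd_from_nerve c)
    then have "coeff (from_nerve z t) {} = coeff (from_nerve (boundary c) t) {}"
      by simp
    then show ?thesis
      by (simp add: from_nerve_def)
  next
    case False
    have "coeff (boundary c) t = 0"
    proof (rule ccontr)
      assume "coeff (boundary c) t \<noteq> 0"
      then obtain s v where "coeff c s \<noteq> 0" "t = s - {v}"
        by (rule boundary_coeff)
      then show False
        using c[of s] False by blast
    qed
    then show ?thesis
      using False z[of t] by auto
  qed
qed

text \<open>\<open>W z\<close> bounds the difference of \<open>z\<close> and a chain of the space. Control over all \<open>J\<close> records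
  that \<open>W z\<close> only uses the members of the cover that occur in \<open>z\<close>.\<close>

definition lifting :: "int \<Rightarrow> (('i, 'f::field) chain \<Rightarrow> 'i set \<Rightarrow> ('v, 'f) chain) \<Rightarrow> bool" where
  "lifting m W \<longleftrightarrow> (\<forall>t. chain_linear (\<lambda>z. W z t)) \<and>
     (\<forall>J z. J \<subseteq> I \<longrightarrow> z \<in> cycles (nerve I \<Gamma>) m \<longrightarrow> (\<forall>t. coeff z t \<noteq> 0 \<longrightarrow> t \<subseteq> J) \<longrightarrow>
        W z \<in> bichains J (m + 1)) \<and>
     (\<forall>z\<in>cycles (nerve I \<Gamma>) m. \<forall>t. t \<noteq> {} \<longrightarrow> total_bd (W z) t = from_nerve z t)"

section \<open>Raising the degree of a lift\<close>

lemma linear_family: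
  assumes "\<And>t. chain_linear (\<lambda>z. W z t)"
  shows "W (x + y) = (\<lambda>t. W x t + W y t)" "W (scale_chain a x) = (\<lambda>t. scale_chain a (W x t))"
  using chain_linearD(1,2)[OF assms] by auto

text \<open>This difference is the cycle of the space to which \<open>W z\<close> joins
  \<open>z\<close>. The subtracted term can be nonzero only for \<open>m = -1\<close>.\<close>

lemma total_bd_component_cycle:
  assumes W: "lifting m W" and J: "J \<subseteq> I" and z: "z \<in> cycles (nerve I \<Gamma>) m"
    and supp: "\<And>t. coeff z t \<noteq> 0 \<Longrightarrow> t \<subseteq> J"
  shows "total_bd (W z) {} - from_nerve z {} \<in> cycles (\<Union>i\<in>J. \<Gamma> i) m"
proof -
  have "W z \<in> bichains J (m + 1)"
    using assms by (simp add: lifting_def)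
  then have "(\<lambda>t. total_bd (W z) t - from_nerve z t) \<in> bichains J m"
    using cycles_nerveD(1)[OF z] supp J
    by (intro bichains_diff total_bd_bichains from_nerve_bichains)
  note space = bichains_component[OF this]
  have "boundary (total_bd (W z) {}) = 0"
    using W z by (intro boundary_total_bd_eq_0[OF _ z]) (auto simp: lifting_def)
  then show ?thesis
    using space by (simp add: cycles_def boundary_linear)
qed

text \<open>The new lift is prescribed on basis simplices and extended linearly, which makes it
  defined on all chains and not only on cycles.\<close>

lemma lifting_step:
  fixes W :: "('i, 'f::field) chain \<Rightarrow> 'i set \<Rightarrow> ('v, 'f) chain"
  assumes W: "lifting m W" and m: "-1 \<le> m"
    and van: "\<And>\<sigma>. \<sigma> \<in> nerve I \<Gamma> \<Longrightarrow> int (card \<sigma>) = m + 2 \<Longrightarrow>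
      reduced_homology_vanishes TYPE('f) (\<Union>i\<in>\<sigma>. \<Gamma> i) m"
  shows "\<exists>W'::('i, 'f) chain \<Rightarrow> 'i set \<Rightarrow> ('v, 'f) chain. lifting (m + 1) W'"
proof -
  let ?N = "nerve I \<Gamma>"
  let ?s = "\<lambda>\<sigma>. Poly_Mapping.single \<sigma> (1::'f)"
  let ?A = "{\<sigma> \<in> ?N. int (card \<sigma>) = m + 2}"
  have lin: "chain_linear (\<lambda>z. W z t)" for t
    using W by (simp add: lifting_def)
  have "\<exists>u y. u \<in> bichains \<sigma> (m + 2) \<and>
      (\<forall>t. total_bd u t = W (boundary (?s \<sigma>)) t - from_space y t - from_nerve (?s \<sigma>) t)"
    if \<sigma>: "\<sigma> \<in> ?A" for \<sigma>
  proof -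
    have \<sigma>I: "\<sigma> \<subseteq> I" and fin: "finite \<sigma>" and ne: "\<sigma> \<noteq> {}"
      using \<sigma> by (auto simp: nerve_def)
    have s: "?s \<sigma> \<in> chain_space ?N (m + 1)"
      using \<sigma> by (auto simp: chain_space_iff lookup_single when_def)
    then have b: "boundary (?s \<sigma>) \<in> cycles ?N m"
      using boundary_in_chain_space[OF simplicial_complex_nerve s]
      by (simp add: cycles_def boundary_boundary)
    have supp: "t \<subseteq> \<sigma>" if "coeff (boundary (?s \<sigma>)) t \<noteq> 0" for t
      using that by (rule boundary_coeff) (auto simp: lookup_single when_def split: if_splits)
    have "total_bd (W (boundary (?s \<sigma>))) {} - from_nerve (boundary (?s \<sigma>)) {} \<in>
        boundaries (\<Union>i\<in>\<sigma>. \<Gamma> i) m"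
      using total_bd_component_cycle[OF W \<sigma>I b supp] van \<sigma>
      by (simp add: reduced_homology_vanishes_def)
    then obtain y where y: "y \<in> chain_space (\<Union>i\<in>\<sigma>. \<Gamma> i) (m + 1)"
      "total_bd (W (boundary (?s \<sigma>))) {} - from_nerve (boundary (?s \<sigma>)) {} = boundary y"
      by (auto simp: boundaries_def)
    \<comment> \<open>The closed chain formed by \<open>\<sigma>\<close>, its filling
      \<open>y\<close> and the chain joining their boundaries.\<close>
    define e where "e = (\<lambda>t. W (boundary (?s \<sigma>)) t - from_space y t - from_nerve (?s \<sigma>) t)"
    have Wb: "W (boundary (?s \<sigma>)) \<in> bichains \<sigma> (m + 1)"
      using W b supp \<sigma>I by (simp add: lifting_def)
    have e: "e \<in> bichains \<sigma> (m + 1)"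
      unfolding e_def using s y(1)
      by (intro bichains_diff Wb from_space_bichains from_nerve_bichains)
        (auto simp: lookup_single when_def split: if_splits)
    have bd_s: "total_bd (from_nerve (?s \<sigma>)) t = from_nerve (boundary (?s \<sigma>)) t" for t
      using \<sigma>I by (intro total_bd_from_nerve) (auto simp: lookup_single when_def split: if_splits)
    have bd_e: "total_bd e t = 0" for t
    proof -
      have "total_bd e t = total_bd (W (boundary (?s \<sigma>))) t - from_space (boundary y) t -
          from_nerve (boundary (?s \<sigma>)) t"
        using bd_s unfolding e_def by (simp add: total_bd_linear total_bd_from_space)
      then show ?thesis
        using y(2) W b by (cases "t = {}") (auto simp: lifting_def from_space_def algebra_simps)
    qed
    \<comment> \<open>Up to a total boundary \<open>e\<close> is a chain \<open>c\<close> on faces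
      of \<open>\<sigma>\<close>; the rest shows \<open>c = 0\<close>.\<close>
    obtain c u where c: "c \<in> chain_space ?N (m + 1)" "\<And>t. coeff c t \<noteq> 0 \<Longrightarrow> t \<subseteq> \<sigma>"
      and u: "u \<in> bichains \<sigma> (m + 1 + 1)" and eq: "\<And>t. e t = from_nerve c t + total_bd u t"
      using reduce_to_nerve[OF e \<sigma>I] bd_e by auto
    have "0 = boundary c"
      using c(2) \<sigma>I by (intro boundary_of_reduction[OF eq]) (auto simp: bd_e from_nerve_linear)
    \<comment> \<open>By its degree \<open>c\<close> is a multiple of \<open>\<sigma>\<close>, and a
      nonzero multiple would have nonzero boundary.\<close>
    have "t = \<sigma>" if "coeff c t \<noteq> 0" for t
    proof (rule card_subset_eq[OF fin c(2)[OF that]])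
      have "int (card t) = m + 2"
        using c(1) that by (auto simp: chain_space_iff)
      then show "card t = card \<sigma>"
        using \<sigma> by simp
    qed
    moreover have "coeff c \<sigma> = 0"
    proof -
      obtain v where v: "v \<in> \<sigma>"
        using ne by blast
      then have "\<sigma> - (\<sigma> - {v}) = {v}" "insert v (\<sigma> - {v}) = \<sigma>"
        by auto
      then have "coeff (boundary c) (\<sigma> - {v}) = vertex_sign \<sigma> v * coeff c \<sigma>"
        using coeff_boundary[OF fin, of c "\<sigma> - {v}"] c(2) by simp
      then have "vertex_sign \<sigma> v * (vertex_sign \<sigma> v * coeff c \<sigma>) = 0"
        using \<open>0 = boundary c\<close> by (metis lookup_zero mult_zero_right)
      then show ?thesis
        by (simp flip: mult.assoc)
    qed
    ultimately have "c = 0"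
      by (intro poly_mapping_eqI) (metis lookup_zero)
    then have "total_bd u t = e t" for t
      using eq[of t] by (simp add: from_nerve_linear)
    moreover have "u \<in> bichains \<sigma> (m + 2)"
      using u by (simp add: add.assoc)
    ultimately show ?thesis
      by (intro exI[of _ u] exI[of _ y]) (simp add: e_def)
  qed
  then have "\<forall>\<sigma>\<in>?A. \<exists>p. fst p \<in> bichains \<sigma> (m + 2) \<and>
      (\<forall>t. total_bd (fst p) t = W (boundary (?s \<sigma>)) t - from_space (snd p) t - from_nerve (?s \<sigma>) t)"
    by simp
  from bchoice[OF this] obtain p where p: "\<forall>\<sigma>\<in>?A. fst (p \<sigma>) \<in> bichains \<sigma> (m + 2) \<and>
      (\<forall>t. total_bd (fst (p \<sigma>)) t = W (boundary (?s \<sigma>)) t - from_space (snd (p \<sigma>)) t - from_nerve (?s \<sigma>) t)"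
    by (rule exE)
  define u where "u = (\<lambda>\<sigma>. fst (p \<sigma>))"
  define y where "y = (\<lambda>\<sigma>. snd (p \<sigma>))"
  have u: "\<And>\<sigma>. \<sigma> \<in> ?A \<Longrightarrow> u \<sigma> \<in> bichains \<sigma> (m + 2)"
    and bd_u: "\<And>\<sigma> t. \<sigma> \<in> ?A \<Longrightarrow>
      total_bd (u \<sigma>) t = W (boundary (?s \<sigma>)) t - from_space (y \<sigma>) t - from_nerve (?s \<sigma>) t"
    using p by (simp_all add: u_def y_def)
  have fin: "finite ?A"
    using finite_I by (auto simp: nerve_def intro: finite_subset[of _ "Pow I"])
  \<comment> \<open>The minus sign offsets the sign of \<open>from_nerve\<close> in
    \<open>bd_u\<close>.\<close>
  define W' where "W' = (\<lambda>z t. \<Sum>\<sigma>\<in>?A. scale_chain (- coeff z \<sigma>) (u \<sigma> t))"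
  have "lifting (m + 1) W'"
    unfolding lifting_def
  proof (intro conjI allI impI ballI)
    show "chain_linear (\<lambda>z. W' z t)" for t
      by (rule chain_linearI)
        (simp_all add: W'_def lookup_add scale_chain_lookup chain.scale_left_distrib
          chain.scale_sum_right sum.distrib sum_negf sum_subtractf)
  next
    fix J and z :: "('i, 'f) chain"
    assume J: "J \<subseteq> I" "\<forall>t. coeff z t \<noteq> 0 \<longrightarrow> t \<subseteq> J"
    have "(\<lambda>t. scale_chain (- coeff z \<sigma>) (u \<sigma> t)) \<in> bichains J (m + 2)" if "\<sigma> \<in> ?A" for \<sigma>
    proof (cases "coeff z \<sigma> = 0")
      case True
      then show ?thesis
        by (simp add: bichains_zero)
    next
      case False
      then show ?thesis
        using J by (intro bichains_scale bichains_mono[OF u[OF that]]) auto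
    qed
    then show "W' z \<in> bichains J (m + 1 + 1)"
      unfolding W'_def by (intro bichains_sum) (simp add: add.assoc)
  next
    fix z :: "('i, 'f) chain" and t :: "'i set"
    assume z: "z \<in> cycles ?N (m + 1)" and t: "t \<noteq> {}"
    \<comment> \<open>Here \<open>-1 \<le> m\<close> excludes the empty simplex from the support of
      \<open>z\<close>.\<close>
    have "Poly_Mapping.keys z \<subseteq> ?A"
      using cycles_nerveD(4,5)[OF z] m by (fastforce simp: in_keys_iff)
    with fin have zA: "z = (\<Sum>\<sigma>\<in>?A. scale_chain (coeff z \<sigma>) (?s \<sigma>))"
      by (rule chain_expand)
    have "total_bd (W' z) t = (\<Sum>\<sigma>\<in>?A. scale_chain (- coeff z \<sigma>) (W (boundary (?s \<sigma>)) t - from_nerve (?s \<sigma>) t))"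
      unfolding W'_def total_bd_sum total_bd_linear
      using t by (intro sum.cong) (simp_all add: bd_u from_space_def)
    also have "\<dots> = (\<Sum>\<sigma>\<in>?A. scale_chain (coeff z \<sigma>) (from_nerve (?s \<sigma>) t)) -
        (\<Sum>\<sigma>\<in>?A. scale_chain (coeff z \<sigma>) (W (boundary (?s \<sigma>)) t))"
      by (simp add: chain.scale_right_diff_distrib sum_subtractf sum_negf)
    also have "(\<Sum>\<sigma>\<in>?A. scale_chain (coeff z \<sigma>) (from_nerve (?s \<sigma>) t)) = from_nerve z t"
      by (subst (2) zA) (simp add: chain_linearD[OF chain_linear_from_nerve])
    also have "(\<Sum>\<sigma>\<in>?A. scale_chain (coeff z \<sigma>) (W (boundary (?s \<sigma>)) t)) = W (boundary z) t"
      by (subst (2) zA) (simp add: boundary_linear chain_linearD[OF lin])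
    also have "W (boundary z) t = 0"
      using cycles_nerveD(2)[OF z] chain_linearD(3)[OF lin] by simp
    finally show "total_bd (W' z) t = from_nerve z t"
      by simp
  qed
  then show ?thesis
    by blast
qed

text \<open>The zig-zag proceeds by descending induction on \<open>|t|\<close>; \<open>j\<close> is the level reached.\<close>

definition lifting_above :: "int \<Rightarrow> nat \<Rightarrow> (('i, 'f::field) chain \<Rightarrow> 'i set \<Rightarrow> ('v, 'f) chain) \<Rightarrow> bool" where
  "lifting_above k j W \<longleftrightarrow> (\<forall>t. chain_linear (\<lambda>z. W z t)) \<and>
     (\<forall>J z. J \<subseteq> I \<longrightarrow> z \<in> cycles (nerve I \<Gamma>) k \<longrightarrow> (\<forall>t. coeff z t \<noteq> 0 \<longrightarrow> t \<subseteq> J) \<longrightarrow>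
        W z \<in> bichains J (k + 1)) \<and>
     (\<forall>z\<in>cycles (nerve I \<Gamma>) k. \<forall>t\<subseteq>I. j \<le> card t \<longrightarrow> total_bd (W z) t = from_nerve z t) \<and>
     (\<forall>z t. card t < j \<longrightarrow> W z t = 0)"

text \<open>A \<open>k\<close>-cycle is supported on sets of size \<open>k + 1\<close>, so from
  level \<open>k + 2\<close> on there is nothing to bound.\<close>

lemma lifting_above_top: "lifting_above k (nat (k + 2)) (\<lambda>(z :: ('i, 'f::field) chain) t. 0)"
proof -
  have "from_nerve z t = (0 :: ('v, 'f) chain)"
    if "z \<in> cycles (nerve I \<Gamma>) k" "nat (k + 2) \<le> card t" for z :: "('i, 'f) chain" and t
    using cycles_nerveD(4)[OF that(1), of t] that(2) by (force simp: from_nerve_def)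
  then show ?thesis
    by (simp add: lifting_above_def chain_linearI bichains_zero total_bd_linear)
qed

text \<open>For \<open>t\<close> of size \<open>j\<close> the required equation asks for a filling
  of \<open>e z t\<close> in the intersection over \<open>t\<close>. The levels above make
  \<open>e z t\<close> a cycle, and the vanishing hypothesis makes it a boundary.\<close>

lemma lifting_above_step:
  fixes W :: "('i, 'f::field) chain \<Rightarrow> 'i set \<Rightarrow> ('v, 'f) chain"
  assumes W: "lifting_above k (Suc j) W" and j: "0 < j" "int j \<le> k + 1"
    and van: "\<And>\<sigma>. \<sigma> \<in> nerve I \<Gamma> \<Longrightarrow> int (card \<sigma>) \<le> k + 1 \<Longrightarrow>
      reduced_homology_vanishes TYPE('f) (\<Inter>i\<in>\<sigma>. \<Gamma> i) (k - int (card \<sigma>))"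
  shows "\<exists>W'::('i, 'f) chain \<Rightarrow> 'i set \<Rightarrow> ('v, 'f) chain. lifting_above k j W'"
proof -
  let ?N = "nerve I \<Gamma>"
  have lin: "chain_linear (\<lambda>z. W z t)"
    and Wb: "J \<subseteq> I \<Longrightarrow> z \<in> cycles ?N k \<Longrightarrow> (\<And>t. coeff z t \<noteq> 0 \<Longrightarrow> t \<subseteq> J) \<Longrightarrow> W z \<in> bichains J (k + 1)"
    and Wbd: "z \<in> cycles ?N k \<Longrightarrow> t \<subseteq> I \<Longrightarrow> Suc j \<le> card t \<Longrightarrow> total_bd (W z) t = from_nerve z t"
    and W0: "card t < Suc j \<Longrightarrow> W z t = 0" for J z t
    using W by (simp_all add: lifting_above_def)
  have "\<forall>t. \<exists>g :: ('v, 'f) chain \<Rightarrow> ('v, 'f) chain. chain_linear g \<and>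
      (\<forall>b\<in>boundaries (\<Inter>i\<in>t. \<Gamma> i) (k - int j).
        g b \<in> chain_space (\<Inter>i\<in>t. \<Gamma> i) (k - int j + 1) \<and> boundary (g b) = b)"
    by (rule allI, rule boundary_section) blast
  from choice[OF this] obtain g :: "'i set \<Rightarrow> ('v, 'f) chain \<Rightarrow> ('v, 'f) chain" where
    g_lin: "\<And>t. chain_linear (g t)" and
    g: "\<And>t b. b \<in> boundaries (\<Inter>i\<in>t. \<Gamma> i) (k - int j) \<Longrightarrow>
      g t b \<in> chain_space (\<Inter>i\<in>t. \<Gamma> i) (k - int j + 1) \<and> boundary (g t b) = b"
    by blast
  \<comment> \<open>The equation \<open>total_bd (W' z) t = from_nerve z t\<close>, solved for
    \<open>boundary (W' z t)\<close>.\<close>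
  define e where "e = (\<lambda>z t. scale_chain ((- 1) ^ j) (from_nerve z t - nerve_bd (W z) t))"
  define W' where "W' = (\<lambda>z t. if card t = j \<and> t \<in> ?N then g t (e z t) else W z t)"
  have e_lin: "chain_linear (\<lambda>z. e z t)" for t
    by (rule chain_linearI)
      (simp_all add: e_def linear_family[of W, OF lin] nerve_bd_linear from_nerve_linear
        chain.scale_right_distrib chain.scale_right_diff_distrib mult.commute)
  have e_bichains: "e z \<in> bichains J k"
    if "J \<subseteq> I" "z \<in> cycles ?N k" "\<And>t. coeff z t \<noteq> 0 \<Longrightarrow> t \<subseteq> J" for J z
    unfolding e_def
    by (intro bichains_scale bichains_diff from_nerve_bichains nerve_bd_bichains Wb cycles_nerveD(1) that)
  have e_boundary: "e z t \<in> boundaries (\<Inter>i\<in>t. \<Gamma> i) (k - int j)"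
    if z: "z \<in> cycles ?N k" and t: "t \<in> ?N" "card t = j" for z t
  proof -
    have tI: "t \<subseteq> I" "finite t" "t \<noteq> {}"
      using t(1) by (auto simp: nerve_def)
    have "e z \<in> bichains I k"
      using cycles_nerveD[OF z] by (intro e_bichains z) auto
    note c = bichainsD[OF this, of t]
    have "e z t \<in> chain_space (\<Inter>i\<in>t. \<Gamma> i) (k - int j)"
      unfolding chain_space_iff
    proof (intro allI impI)
      fix s
      assume s: "coeff (e z t) s \<noteq> 0"
      show "s \<in> insert {} (\<Inter>i\<in>t. \<Gamma> i) \<and> int (card s) = k - int j + 1"
        using c[OF s] t(2) by (cases "s = {}") (auto simp: cell_def)
    qed
    \<comment> \<open>\<open>W z\<close> vanishes at size \<open>j\<close>, so there
      \<open>total_bd (W z) t\<close> is just \<open>nerve_bd (W z) t\<close>.\<close>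
    moreover have "boundary (total_bd (W z) t) = 0"
      using tI t(2) by (intro boundary_total_bd_eq_0[OF _ z] Wbd z) auto
    then have "boundary (e z t) = 0"
      using W0[of t z] t(2) by (simp add: total_bd_def e_def boundary_linear)
    ultimately have "e z t \<in> cycles (\<Inter>i\<in>t. \<Gamma> i) (k - int j)"
      by (simp add: cycles_def)
    then show ?thesis
      using van[OF t(1)] t(2) j(2) by (simp add: reduced_homology_vanishes_def)
  qed
  have "lifting_above k j W'"
    unfolding lifting_above_def
  proof (intro conjI allI impI ballI)
    show "chain_linear (\<lambda>z. W' z t)" for t
      by (rule chain_linearI)
        (simp_all add: W'_def chain_linearD[OF lin] chain_linearD[OF e_lin] chain_linearD[OF g_lin])
  next
    fix J and z :: "('i, 'f) chain"
    assume J: "J \<subseteq> I" and z: "z \<in> cycles ?N k" and supp: "\<forall>t. coeff z t \<noteq> 0 \<longrightarrow> t \<subseteq> J"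
    have Wz: "W z \<in> bichains J (k + 1)" and ez: "e z \<in> bichains J k"
      using J z supp by (auto intro: Wb e_bichains)
    show "W' z \<in> bichains J (k + 1)"
    proof (rule bichainsI)
      fix t s
      assume nz: "coeff (W' z t) s \<noteq> 0"
      show "cell J t s \<and> int (card s) + int (card t) = k + 1 + 1"
      proof (cases "card t = j \<and> t \<in> ?N")
        case True
        then have nz: "coeff (g t (e z t)) s \<noteq> 0"
          using nz by (simp add: W'_def)
        \<comment> \<open>Linearity of \<open>g t\<close> sends 0 to 0, so the fillings do not leave
          \<open>J\<close>.\<close>
        then have "e z t \<noteq> 0"
          using chain_linearD(3)[OF g_lin, of t] by (metis lookup_zero)
        then have t: "t \<subseteq> J"
          using bichains_eq_0[OF ez] by blast
        have "g t (e z t) \<in> chain_space (\<Inter>i\<in>t. \<Gamma> i) (k - int j + 1)"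
          using g e_boundary z True by blast
        then have s: "s = {} \<or> s \<in> (\<Inter>i\<in>t. \<Gamma> i)" "int (card s) = k - int j + 2"
          using nz by (auto simp: chain_space_iff)
        have "t \<noteq> {}"
          using True j(1) by auto
        then have "cell J t s"
          using s t True by (auto simp: cell_def)
        then show ?thesis
          using s True by simp
      next
        case False
        then have "W' z t = W z t"
          by (auto simp: W'_def)
        then show ?thesis
          using bichainsD[OF Wz, of t s] nz by simp
      qed
    qed
  next
    fix z :: "('i, 'f) chain" and t :: "'i set"
    assume z: "z \<in> cycles ?N k" and t: "t \<subseteq> I" "j \<le> card t"
    have fin: "finite t"
      using t(1) finite_I by (rule finite_subset)
    \<comment> \<open>Cofaces of \<open>t\<close> have size above \<open>j\<close>, where
      \<open>W'\<close> agrees with \<open>W\<close>.\<close>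
    have bd: "nerve_bd (W' z) t = nerve_bd (W z) t"
      unfolding nerve_bd_def using t(2) fin by (intro sum.cong) (auto simp: W'_def)
    show "total_bd (W' z) t = from_nerve z t"
    proof (cases "card t = j")
      case False
      then have "total_bd (W' z) t = total_bd (W z) t"
        using bd by (simp add: total_bd_def W'_def)
      then show ?thesis
        using Wbd[OF z t(1)] t(2) False by simp
    next
      case card: True
      have W'_t: "boundary (W' z t) = e z t"
      proof (cases "t \<in> ?N")
        case True
        then show ?thesis
          using g e_boundary[OF z True card] card by (simp add: W'_def)
      next
        case False
        \<comment> \<open>There is no cell over a nonempty \<open>t\<close> outside the
          nerve.\<close>
        have "e z t = 0"
        proof (rule poly_mapping_eqI, rule ccontr)
          fix s
          assume "coeff (e z t) s \<noteq> coeff 0 s"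
          moreover have "e z \<in> bichains I k"
            using cycles_nerveD[OF z] by (intro e_bichains z) auto
          ultimately have "cell I t s"
            using bichainsD(1) by (metis lookup_zero)
          moreover have "t \<noteq> {}"
            using card j(1) by auto
          ultimately show False
            using False nerveI[of t s] by (auto simp: cell_def split: if_splits)
        qed
        then show ?thesis
          using False W0[of t z] card by (simp add: W'_def)
      qed
      then show ?thesis
        using card by (simp add: total_bd_def bd e_def flip: power_add mult_2)
    qed
  next
    fix z :: "('i, 'f) chain" and t :: "'i set"
    assume "card t < j"
    then show "W' z t = 0"
      using W0[of t z] by (simp add: W'_def)
  qed
  then show ?thesis
    by blast
qed

text \<open>The zig-zag descends from level \<open>k + 2\<close> to level 1, that is, through all
  nonempty \<open>t\<close>. For \<open>k = -1\<close> the two levels coincide and nothing is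
  filled.\<close>

lemma lifting_base:
  assumes k: "-1 \<le> k"
    and van: "\<And>\<sigma>. \<sigma> \<in> nerve I \<Gamma> \<Longrightarrow> int (card \<sigma>) \<le> k + 1 \<Longrightarrow>
      reduced_homology_vanishes TYPE('f::field) (\<Inter>i\<in>\<sigma>. \<Gamma> i) (k - int (card \<sigma>))"
  shows "\<exists>W::('i, 'f) chain \<Rightarrow> 'i set \<Rightarrow> ('v, 'f) chain. lifting k W"
proof -
  have "1 \<le> nat (k + 2)"
    using k by simp
  then have "\<exists>W::('i, 'f) chain \<Rightarrow> 'i set \<Rightarrow> ('v, 'f) chain. lifting_above k 1 W"
  proof (induction rule: inc_induct)
    case base
    show ?case
      using lifting_above_top by blast
  next
    case (step j)
    then obtain W :: "('i, 'f) chain \<Rightarrow> 'i set \<Rightarrow> ('v, 'f) chain" where "lifting_above k (Suc j) W"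
      by blast
    then show ?case
      using step.hyps by (intro lifting_above_step van) simp_all
  qed
  then obtain W :: "('i, 'f) chain \<Rightarrow> 'i set \<Rightarrow> ('v, 'f) chain" where W: "lifting_above k 1 W"
    by blast
  have lin: "chain_linear (\<lambda>z. W z t)"
    and Wb: "J \<subseteq> I \<Longrightarrow> z \<in> cycles (nerve I \<Gamma>) k \<Longrightarrow> \<forall>t. coeff z t \<noteq> 0 \<longrightarrow> t \<subseteq> J \<Longrightarrow> W z \<in> bichains J (k + 1)"
    and Wbd: "z \<in> cycles (nerve I \<Gamma>) k \<Longrightarrow> t \<subseteq> I \<Longrightarrow> 1 \<le> card t \<Longrightarrow> total_bd (W z) t = from_nerve z t"
    for J z t
    using W by (simp_all add: lifting_above_def)
  have "total_bd (W z) t = from_nerve z t" if z: "z \<in> cycles (nerve I \<Gamma>) k" and t: "t \<noteq> {}" for z t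
  proof (cases "t \<subseteq> I")
    case True
    moreover from this have "1 \<le> card t"
      using t finite_I by (simp add: Suc_le_eq card_gt_0_iff finite_subset)
    ultimately show ?thesis
      using Wbd z by simp
  next
    case False
    have "W z \<in> bichains I (k + 1)"
      using cycles_nerveD(3)[OF z] by (intro Wb z) auto
    then have "total_bd (W z) \<in> bichains I k"
      by (rule total_bd_bichains) simp
    then have "total_bd (W z) t = 0"
      using False by (rule bichains_eq_0)
    moreover have "coeff z t = 0"
      using False cycles_nerveD(3)[OF z] by blast
    ultimately show ?thesis
      by (simp add: from_nerve_def)
  qed
  then have "lifting k W"
    by (simp add: lifting_def lin Wb)
  then show ?thesis
    by blast
qed

text \<open>Intersections give the start in degree \<open>k\<close>; each passage from
  \<open>m\<close> to \<open>m + 1\<close> uses the unions of \<open>m + 2\<close> members.\<close>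

lemma lifting_exists:
  assumes k: "-1 \<le> k" and l: "k \<le> l"
    and van_Int: "\<And>\<sigma>. \<sigma> \<in> nerve I \<Gamma> \<Longrightarrow> int (card \<sigma>) \<le> k + 1 \<Longrightarrow>
      reduced_homology_vanishes TYPE('f::field) (\<Inter>i\<in>\<sigma>. \<Gamma> i) (k - int (card \<sigma>))"
    and van_Un: "\<And>\<sigma>. \<sigma> \<in> nerve I \<Gamma> \<Longrightarrow> k + 2 \<le> int (card \<sigma>) \<Longrightarrow> int (card \<sigma>) \<le> l + 1 \<Longrightarrow>
      reduced_homology_vanishes TYPE('f) (\<Union>i\<in>\<sigma>. \<Gamma> i) (int (card \<sigma>) - 2)"
  shows "\<exists>W::('i, 'f) chain \<Rightarrow> 'i set \<Rightarrow> ('v, 'f) chain. lifting l W"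
  using l van_Un
proof (induction l rule: int_ge_induct)
  case base
  show ?case
    using lifting_base[OF k van_Int] by blast
next
  case (step m)
  have "\<exists>W::('i, 'f) chain \<Rightarrow> 'i set \<Rightarrow> ('v, 'f) chain. lifting m W"
    by (rule step.IH) (simp add: step.prems)
  then obtain W :: "('i, 'f) chain \<Rightarrow> 'i set \<Rightarrow> ('v, 'f) chain" where W: "lifting m W"
    by blast
  show ?case
  proof (rule lifting_step[OF W])
    show "-1 \<le> m"
      using k step.hyps by simp
    fix \<sigma>
    assume \<sigma>: "\<sigma> \<in> nerve I \<Gamma>" "int (card \<sigma>) = m + 2"
    then show "reduced_homology_vanishes TYPE('f) (\<Union>i\<in>\<sigma>. \<Gamma> i) m"
      using step.prems[OF \<sigma>(1)] step.hyps by simp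
  qed
qed

text \<open>\<open>z\<close> is sent to the cycle of the space it is joined to. If that cycle bounds
  \<open>y\<close>, then \<open>W z\<close> minus \<open>y\<close> has total boundary
  \<open>z\<close>, and reducing it to the nerve yields a chain with boundary
  \<open>z\<close>.\<close>

lemma homology_dim_le_of_lifting:
  fixes W :: "('i, 'f::field) chain \<Rightarrow> 'i set \<Rightarrow> ('v, 'f) chain"
  assumes W: "lifting l W"
  shows "reduced_homology_dim TYPE('f) (nerve I \<Gamma>) l \<le> reduced_homology_dim TYPE('f) (\<Union>i\<in>I. \<Gamma> i) l"
  unfolding reduced_homology_dim_def
proof (rule quotient_dim_mono)
  let ?f = "\<lambda>z. total_bd (W z) {} - from_nerve z {}"
  have lin: "chain_linear (\<lambda>z. W z t)" for t
    using W by (simp add: lifting_def)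
  show "chain_linear ?f"
    by (rule chain_linearI)
      (simp_all add: linear_family[of W, OF lin] total_bd_linear from_nerve_linear
        chain.scale_right_diff_distrib)
  show "chain.subspace (cycles (nerve I \<Gamma>) l)"
    by (rule subspace_cycles)
  show "?f ` cycles (nerve I \<Gamma>) l \<subseteq> cycles (\<Union>i\<in>I. \<Gamma> i) l"
    using total_bd_component_cycle[OF W order_refl] cycles_nerveD(3) by blast
  show "0 \<in> boundaries (\<Union>i\<in>I. \<Gamma> i) l"
    unfolding boundaries_def by (rule image_eqI[where x = 0]) (simp_all add: chain_space_iff)
  fix z :: "('i, 'f) chain"
  assume z: "z \<in> cycles (nerve I \<Gamma>) l" and "?f z \<in> boundaries (\<Union>i\<in>I. \<Gamma> i) l"
  then obtain y where y: "y \<in> chain_space (\<Union>i\<in>I. \<Gamma> i) (l + 1)" "?f z = boundary y"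
    by (auto simp: boundaries_def)
  define w where "w = (\<lambda>t. W z t - from_space y t)"
  have "W z \<in> bichains I (l + 1)"
    using W z cycles_nerveD(3)[OF z] by (simp add: lifting_def)
  then have w: "w \<in> bichains I (l + 1)"
    unfolding w_def using y(1) by (intro bichains_diff from_space_bichains)
  have bd: "total_bd w t = from_nerve z t" for t
  proof -
    have "total_bd w t = total_bd (W z) t - from_space (boundary y) t"
      by (simp add: w_def total_bd_linear total_bd_from_space)
    then show ?thesis
      using W z y(2) by (cases "t = {}") (auto simp: lifting_def from_space_def algebra_simps)
  qed
  obtain c u where c: "c \<in> chain_space (nerve I \<Gamma>) (l + 1)" "\<And>t. coeff c t \<noteq> 0 \<Longrightarrow> t \<subseteq> I"
    and eq: "\<And>t. w t = from_nerve c t + total_bd u t"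
    by (rule reduce_to_nerve[OF w order_refl]) (auto simp: bd from_nerve_def lookup_single_not_eq)
  have "z = boundary c"
    using eq bd c(2) cycles_nerveD(3)[OF z] by (rule boundary_of_reduction)
  then show "z \<in> boundaries (nerve I \<Gamma>) l"
    using c(1) by (auto simp: boundaries_def)
qed

end

theorem theorem1:
  fixes X :: "'v set set" and \<Gamma> :: "'i \<Rightarrow> 'v set set" and I :: "'i set" and k l :: int
  assumes "simplicial_complex X"
    and "finite I"
    and "\<And>i. i \<in> I \<Longrightarrow> subcomplex (\<Gamma> i) X"
    and "(\<Union>i\<in>I. \<Gamma> i) = X"
    and "-1 \<le> k" and "k \<le> l" and "l < int (card I)"
    and "\<And>\<sigma>. \<sigma> \<in> nerve I \<Gamma> \<Longrightarrow> simplex_dim \<sigma> \<le> k \<Longrightarrow>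
           reduced_homology_vanishes TYPE('f::field) (\<Inter>i\<in>\<sigma>. \<Gamma> i) (k - int (card \<sigma>))"
    and "\<And>\<sigma>. \<sigma> \<in> nerve I \<Gamma> \<Longrightarrow> k + 1 \<le> simplex_dim \<sigma> \<Longrightarrow> simplex_dim \<sigma> \<le> l \<Longrightarrow>
           reduced_homology_vanishes TYPE('f) (\<Union>i\<in>\<sigma>. \<Gamma> i) (int (card \<sigma>) - 2)"
  shows "reduced_homology_dim TYPE('f) (nerve I \<Gamma>) l \<le> reduced_homology_dim TYPE('f) X l"
proof -
  interpret cover I \<Gamma>
    using assms(2,3) by unfold_locales (simp_all add: subcomplex_def)
  \<comment> \<open>The bounds on \<open>simplex_dim\<close> become bounds on \<open>card\<close>
    that are larger by one.\<close>
  have "\<exists>W::('i, 'f) chain \<Rightarrow> 'i set \<Rightarrow> ('v, 'f) chain. lifting l W"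
    using assms(5,6) by (rule lifting_exists) (simp_all add: assms(8,9) simplex_dim_def)
  then show ?thesis
    using homology_dim_le_of_lifting assms(4) by blast
qed

end
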